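(* Let $N\geq 1$, $0<s<1$ and $c>0$. If $0<\sigma<\frac{2s}{N}$, then the constrained minimization problem $$I_c=\inf\{\mathcal{J}(u): u\in S_c\}$$ admits a nonnegative, radial and radially decreasing minimizer; that is, there exists $u\in S_c$ with $\mathcal{J}(u)=I_c$ such that $u$ is nonnegative, radial and radially decreasing.
   Context: For $0<s<1$, $H_s(\mathbb{R}^N)=\{u\in L^2(\mathbb{R}^N): \int_{\mathbb{R}^N}\int_{\mathbb{R}^N}\frac{|u(x)-u(y)|^2}{|x-y|^{N+2s}}\,dy\,dx<\infty\}$, and $$\|\nabla_s u\|_{2}^2=\|\nabla_s u\|_{L^2(\mathbb{R}^N)}^2=C_{N,s}\int_{\mathbb{R}^N}\int_{\mathbb{R}^N}\frac{|u(x)-u(y)|^2}{|x-y|^{N+2s}}\,dx\,dy,$$ where $C_{N,s}>0$ is a normalization constant. Functions here are real-valued. Set $$\Sigma_s(\mathbb{R}^N)=\{u\in H_s(\mathbb{R}^N): \|u\|_{\Sigma_s(\mathbb{R}^N)}:=\|u\|_{L^2(\mathbb{R}^N)}+\|\nabla_s u\|_{L^2(\mathbb{R}^N)}+\|xu\|_{L^2(\mathbb{R}^N)}<\infty\}.$$ The functional is $$\mathcal{J}(u)=\frac12\|\nabla_s u\|_2^2+\frac12\int_{\mathbb{R}^N}|x|^2|u|^2\,dx-\frac{1}{2\sigma+2}\int_{\mathbb{R}^N}|u|^{2\sigma+2}\,dx,$$ and $S_c=\{u\in\Sigma_s(\mathbb{R}^N): \int_{\mathbb{R}^N}|u|^2\,dx=c^2\}$.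 *)

theory Defs
  imports "HOL-Analysis.Analysis"
begin

text \<open>
  The dimension \<open>N\<close> is \<open>CARD('n)\<close>. Functions are representatives of their almost-everywhere classes:
  real-valued, Lebesgue measurable functions on \<open>real ^ 'n\<close>. All integrals below have nonnegative
  integrands and are taken in \<open>[0, \<infinity>]\<close>.
\<close>

definition sqrt_ennreal :: "ennreal \<Rightarrow> ennreal" where
  "sqrt_ennreal a = (if a = \<infinity> then \<infinity> else ennreal (sqrt (enn2real a)))"

definition L2_norm :: "(real ^ 'n \<Rightarrow> 'b::real_normed_vector) \<Rightarrow> ennreal" where
  "L2_norm f = sqrt_ennreal (\<integral>\<^sup>+x. ennreal ((norm (f x))\<^sup>2) \<partial>lebesgue)"

definition L2 :: "(real ^ 'n \<Rightarrow> real) set" where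
  "L2 = {u. u \<in> borel_measurable lebesgue \<and> L2_norm u < \<infinity>}"

text \<open>On the diagonal \<open>x = y\<close> the integrand is \<open>0 / 0 = 0\<close>; the diagonal is a null set.\<close>

definition gagliardo :: "real \<Rightarrow> (real ^ 'n \<Rightarrow> real) \<Rightarrow> ennreal" where
  "gagliardo s u =
     (\<integral>\<^sup>+x. (\<integral>\<^sup>+y. ennreal (\<bar>u x - u y\<bar>\<^sup>2 / norm (x - y) powr (real CARD('n) + 2 * s))
        \<partial>lebesgue) \<partial>lebesgue)"

definition Hs :: "real \<Rightarrow> (real ^ 'n \<Rightarrow> real) set" where
  "Hs s = {u \<in> L2. gagliardo s u < \<infinity>}"

text \<open>
  The parameter \<open>C\<close> is the normalization constant \<open>C\<^sub>N\<^sub>,\<^sub>s\<close>, of which only positivity is used.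
\<close>

definition grad_s_sq :: "real \<Rightarrow> real \<Rightarrow> (real ^ 'n \<Rightarrow> real) \<Rightarrow> ennreal" where
  "grad_s_sq C s u = ennreal C * gagliardo s u"

definition Sigma_norm :: "real \<Rightarrow> real \<Rightarrow> (real ^ 'n \<Rightarrow> real) \<Rightarrow> ennreal" where
  "Sigma_norm C s u =
     L2_norm u + sqrt_ennreal (grad_s_sq C s u) + L2_norm (\<lambda>x. u x *\<^sub>R x)"

definition Sigma_s :: "real \<Rightarrow> real \<Rightarrow> (real ^ 'n \<Rightarrow> real) set" where
  "Sigma_s C s = {u \<in> Hs s. Sigma_norm C s u < \<infinity>}"

text \<open>
  The first two terms are finite on \<open>Sigma_s\<close>, so the difference is never \<open>\<infinity> - \<infinity>\<close> there.
  The values are extended reals so that neither the last integral nor the infimum of the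
  functional is assumed to be finite.
\<close>

definition J_functional :: "real \<Rightarrow> real \<Rightarrow> real \<Rightarrow> (real ^ 'n \<Rightarrow> real) \<Rightarrow> ereal" where
  "J_functional C s \<sigma> u =
     ereal (1 / 2) * enn2ereal (grad_s_sq C s u)
     + ereal (1 / 2) * enn2ereal (\<integral>\<^sup>+x. ennreal ((norm x)\<^sup>2 * \<bar>u x\<bar>\<^sup>2) \<partial>lebesgue)
     - ereal (1 / (2 * \<sigma> + 2)) * enn2ereal (\<integral>\<^sup>+x. ennreal (\<bar>u x\<bar> powr (2 * \<sigma> + 2)) \<partial>lebesgue)"

definition S_constraint :: "real \<Rightarrow> real \<Rightarrow> real \<Rightarrow> (real ^ 'n \<Rightarrow> real) set" where
  "S_constraint C s c =
     {u \<in> Sigma_s C s. (\<integral>\<^sup>+x. ennreal (\<bar>u x\<bar>\<^sup>2) \<partial>lebesgue) = ennreal (c\<^sup>2)}"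

definition I_min :: "'n::finite itself \<Rightarrow> real \<Rightarrow> real \<Rightarrow> real \<Rightarrow> real \<Rightarrow> ereal" where
  "I_min _ C s \<sigma> c = (INF u \<in> (S_constraint C s c :: (real ^ 'n \<Rightarrow> real) set). J_functional C s \<sigma> u)"

definition radial :: "(real ^ 'n \<Rightarrow> real) \<Rightarrow> bool" where
  "radial u \<longleftrightarrow> (\<forall>x y. norm x = norm y \<longrightarrow> u x = u y)"

text \<open>
  Decreasing means nonincreasing in \<open>norm x > 0\<close>. The origin is excluded because a radially
  decreasing function in \<open>L\<^sup>2\<close> may be unbounded near it, and then no real value there would do.
\<close>

definition radially_decreasing :: "(real ^ 'n \<Rightarrow> real) \<Rightarrow> bool" where
  "radially_decreasing u \<longleftrightarrow> (\<forall>x y. 0 < norm x \<and> norm x \<le> norm y \<longrightarrow> u y \<le> u x)"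

end

theory Submission
  imports Defs "HOL-Complex_Analysis.Great_Picard"
begin

text \<open>
  The functional is minimized by the direct method, and the symmetry of the minimizer is read off
  from its minimality by means of reflections.

  \<^emph>\<open>Coercivity.\<close> The condition \<open>\<sigma> < 2 s / N\<close> says that the power \<open>2 \<sigma> + 2\<close> lies below the
  mass-critical exponent \<open>2 + 4 s / N\<close>. For fixed mass, the integral of \<open>\<bar>u\<bar>\<close> to that power is then at
  most a constant plus an arbitrarily small multiple of the Gagliardo energy (lemma
  \<open>power_integral_coercive\<close>), so minimizing sequences are bounded in \<open>\<Sigma>\<^sub>s\<close>.

  \<^emph>\<open>Compactness.\<close> The weight \<open>\<bar>x\<bar>\<^sup>2\<close> keeps the mass from escaping to infinity and the Gagliardo
  energy keeps it from oscillating, so a bounded sequence in \<open>\<Sigma>\<^sub>s\<close> has a subsequence that converges in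
  \<open>L\<^sup>2\<close> and almost everywhere (lemma \<open>bounded_Sigma_sequence_convergent_subsequence\<close>). The
  Gagliardo--Nirenberg inequality, applied to differences, turns \<open>L\<^sup>2\<close> convergence into convergence of
  the power integral; Fatou's lemma handles the two positive terms. The limit is a minimizer.

  \<^emph>\<open>Symmetry.\<close> Replacing \<open>u\<close> by \<open>\<bar>u\<bar>\<close>, one may take the minimizer nonnegative. Let \<open>\<rho>\<close> be the
  reflection in a hyperplane that misses the origin. Polarization moves, in each pair \<open>x\<close>, \<open>\<rho> x\<close>, the
  larger value of \<open>u\<close> to the point on the side of the origin. This keeps the mass and the power
  integral, does not increase the Gagliardo energy, and decreases the second moment strictly unless
  nothing is moved. Hence a nonnegative minimizer satisfies \<open>u (\<rho> x) \<le> u x\<close> for almost every \<open>x\<close> on the side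
  of the origin. Any two points with \<open>\<bar>x\<bar> < \<bar>y\<bar>\<close> are exchanged by such a reflection, so averages of \<open>u\<close>
  over small balls around them are ordered; letting the radius tend to zero gives \<open>u y \<le> u x\<close> off a
  null set.

  One estimate is used three times (lemma \<open>deviation_from_average_le\<close>): the deviation of \<open>u x\<close> from the
  average of \<open>u\<close> over a nearby set is controlled by the inner Gagliardo integral at \<open>x\<close>. With a ball
  whose radius depends on \<open>u x\<close> it yields the Gagliardo--Nirenberg inequality, with a grid of cubes it
  yields compactness, and with shrinking balls it recovers \<open>u x\<close> from averages.
\<close>

section \<open>The Gagliardo seminorm, the second moment and the mass\<close>

definition frac_density :: "real \<Rightarrow> (real ^ 'n \<Rightarrow> real) \<Rightarrow> real ^ 'n \<Rightarrow> ennreal" where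
  "frac_density s u x =
     (\<integral>\<^sup>+y. ennreal (\<bar>u x - u y\<bar>\<^sup>2 / norm (x - y) powr (real CARD('n) + 2 * s)) \<partial>lborel)"

definition mass :: "('a::euclidean_space \<Rightarrow> real) \<Rightarrow> ennreal" where
  "mass u = (\<integral>\<^sup>+x. ennreal ((u x)\<^sup>2) \<partial>lborel)"

definition moment :: "('a::euclidean_space \<Rightarrow> real) \<Rightarrow> ennreal" where
  "moment u = (\<integral>\<^sup>+x. ennreal ((norm x)\<^sup>2 * (u x)\<^sup>2) \<partial>lborel)"

definition power_integral :: "real \<Rightarrow> ('a::euclidean_space \<Rightarrow> real) \<Rightarrow> ennreal" where
  "power_integral p u = (\<integral>\<^sup>+x. ennreal (\<bar>u x\<bar> powr p) \<partial>lborel)"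

lemma gagliardo_eq_integral_density: "gagliardo s u = (\<integral>\<^sup>+x. frac_density s u x \<partial>lborel)"
  by (simp add: gagliardo_def frac_density_def nn_integral_completion)

lemma frac_density_measurable [measurable]:
  fixes u :: "real ^ 'n \<Rightarrow> real"
  assumes [measurable]: "u \<in> borel_measurable borel"
  shows "frac_density s u \<in> borel_measurable borel"
proof -
  have "(\<lambda>x. \<integral>\<^sup>+y. ennreal (\<bar>u x - u y\<bar>\<^sup>2 / norm (x - y) powr (real CARD('n) + 2 * s)) \<partial>lborel)
     \<in> borel_measurable borel"
    by measurable
  then show ?thesis
    by (simp add: frac_density_def[abs_def])
qed

lemma frac_density_cong_AE:
  assumes "AE y in lborel. u y = v y" "u x = v x"
  shows "frac_density s u x = frac_density s v x"
  unfolding frac_density_def using assms by (intro nn_integral_cong_AE) auto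

lemma gagliardo_cong_AE:
  assumes "AE y in lborel. u y = v y"
  shows "gagliardo s u = gagliardo s v"
  unfolding gagliardo_eq_integral_density
  using assms by (intro nn_integral_cong_AE) (auto intro: frac_density_cong_AE[OF assms])

lemma mass_cong_AE: "AE y in lborel. u y = v y \<Longrightarrow> mass u = mass v"
  unfolding mass_def by (intro nn_integral_cong_AE) auto

lemma moment_cong_AE: "AE y in lborel. u y = v y \<Longrightarrow> moment u = moment v"
  unfolding moment_def by (intro nn_integral_cong_AE) auto

lemma power_integral_cong_AE:
  "AE y in lborel. u y = v y \<Longrightarrow> power_integral p u = power_integral p v"
  unfolding power_integral_def by (intro nn_integral_cong_AE) auto

lemma sqrt_ennreal_less_top_iff: "sqrt_ennreal a < top \<longleftrightarrow> a < top"
  by (auto simp: sqrt_ennreal_def less_top[symmetric])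

text \<open>
  The norm enters the definition only through its finiteness, which is that of the mass, the energy
  and the second moment. The integrals are rewritten over \<open>lborel\<close>, where Borel representatives can be
  used; completing a measure does not change a nonnegative integral.
\<close>

lemma S_constraint_iff:
  fixes u :: "real ^ 'n \<Rightarrow> real"
  shows "u \<in> S_constraint C s c \<longleftrightarrow>
    u \<in> borel_measurable lebesgue \<and> mass u = ennreal (c\<^sup>2) \<and> gagliardo s u < \<infinity> \<and> moment u < \<infinity>"
proof -
  have "L2_norm (\<lambda>x. u x *\<^sub>R x) = sqrt_ennreal (moment u)"
    by (simp add: L2_norm_def moment_def nn_integral_completion power_mult_distrib mult.commute)
  moreover have "L2_norm u = sqrt_ennreal (mass u)"
    by (simp add: L2_norm_def mass_def nn_integral_completion)
  ultimately show ?thesis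
    by (auto simp: S_constraint_def Sigma_s_def Hs_def L2_def Sigma_norm_def grad_s_sq_def
        sqrt_ennreal_less_top_iff nn_integral_completion mass_def[symmetric] ennreal_mult_less_top)
qed

lemma J_functional_eq:
  "J_functional C s \<sigma> u =
     ereal (1 / 2) * enn2ereal (ennreal C * gagliardo s u) + ereal (1 / 2) * enn2ereal (moment u)
     - ereal (1 / (2 * \<sigma> + 2)) * enn2ereal (power_integral (2 * \<sigma> + 2) u)"
  by (simp add: J_functional_def grad_s_sq_def moment_def power_integral_def nn_integral_completion)

lemma integrable_if_square_integrable_on_finite:
  fixes f :: "'a \<Rightarrow> real"
  assumes [measurable]: "f \<in> borel_measurable M" "Q \<in> sets M"
    and fin: "emeasure M Q < \<infinity>" and sq: "(\<integral>\<^sup>+x. ennreal (indicator Q x * (f x)\<^sup>2) \<partial>M) < \<infinity>"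
  shows "set_integrable M Q f" "set_integrable M Q (\<lambda>x. (f x)\<^sup>2)"
proof -
  show sqi: "set_integrable M Q (\<lambda>x. (f x)\<^sup>2)"
    unfolding set_integrable_def using sq by (intro integrableI_nonneg) auto
  show "set_integrable M Q f"
    unfolding set_integrable_def
  proof (rule Bochner_Integration.integrable_bound)
    show "integrable M (\<lambda>x. indicator Q x + indicator Q x *\<^sub>R (f x)\<^sup>2)"
      using sqi fin by (intro Bochner_Integration.integrable_add) (auto simp: set_integrable_def)
    have "\<bar>t\<bar> \<le> 1 + t\<^sup>2" for t :: real
      using sum_squares_bound[of "\<bar>t\<bar>" 1] by (simp add: power2_eq_square)
    then show "AE x in M. norm (indicator Q x *\<^sub>R f x) \<le> norm (indicator Q x + indicator Q x *\<^sub>R (f x)\<^sup>2)"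
      by (auto simp: indicator_def intro!: order_trans[OF _ abs_ge_self])
  qed auto
qed

text \<open>
  The integral of \<open>(f - a)\<^sup>2\<close> over \<open>Q\<close>, with \<open>a\<close> the average of \<open>f\<close>, is nonnegative.
\<close>

lemma square_average_le_average_square:
  fixes f :: "'a \<Rightarrow> real"
  assumes f[measurable]: "f \<in> borel_measurable M" and Q[measurable]: "Q \<in> sets M"
    and fin: "emeasure M Q < \<infinity>" and pos: "0 < measure M Q"
  shows "ennreal (((LINT x:Q|M. f x) / measure M Q)\<^sup>2)
       \<le> ennreal (1 / measure M Q) * (\<integral>\<^sup>+x. ennreal (indicator Q x * (f x)\<^sup>2) \<partial>M)"
proof (cases "(\<integral>\<^sup>+x. ennreal (indicator Q x * (f x)\<^sup>2) \<partial>M) < \<infinity>")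
  case True
  note int = integrable_if_square_integrable_on_finite[OF f Q fin True]
  define m where "m = measure M Q"
  define a where "a = (LINT x:Q|M. f x) / m"
  have m: "m > 0" using pos by (simp add: m_def)
  have one: "set_integrable M Q (\<lambda>x. 1::real)" and one_eq: "(LINT x:Q|M. (1::real)) = m"
    using fin by (auto simp: set_integrable_def set_lebesgue_integral_def m_def)
  have parts: "set_integrable M Q (\<lambda>x. 2 * a * f x)" "set_integrable M Q (\<lambda>x. a\<^sup>2 * 1)"
    by (rule set_integrable_mult_right; rule int one)+
  have I: "(LINT x:Q|M. (f x)\<^sup>2 - 2 * a * f x + a\<^sup>2 * 1)
      = (LINT x:Q|M. (f x)\<^sup>2) - 2 * a * (LINT x:Q|M. f x) + a\<^sup>2 * (LINT x:Q|M. 1)"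
    unfolding set_integral_add(2)[OF set_integral_diff(1)[OF int(2) parts(1)] parts(2)]
      set_integral_diff(2)[OF int(2) parts(1)] set_integral_mult_right ..
  have "0 \<le> (LINT x:Q|M. (f x - a)\<^sup>2)"
    unfolding set_lebesgue_integral_def by (intro Bochner_Integration.integral_nonneg) auto
  also have "\<dots> = (LINT x:Q|M. (f x)\<^sup>2 - 2 * a * f x + a\<^sup>2 * 1)"
    by (simp add: power2_diff algebra_simps)
  also have "\<dots> = (LINT x:Q|M. (f x)\<^sup>2) - m * a\<^sup>2"
    unfolding I one_eq using m by (simp add: a_def power2_eq_square)
  finally have "a\<^sup>2 \<le> (1 / m) * (LINT x:Q|M. (f x)\<^sup>2)"
    using m by (simp add: field_simps)
  then have "ennreal (a\<^sup>2) \<le> ennreal (1 / m) * ennreal (LINT x:Q|M. (f x)\<^sup>2)"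
    using m by (simp add: ennreal_mult'[symmetric] ennreal_leI)
  also have "ennreal (LINT x:Q|M. (f x)\<^sup>2) = (\<integral>\<^sup>+x. ennreal (indicator Q x * (f x)\<^sup>2) \<partial>M)"
    using int(2) unfolding set_lebesgue_integral_def set_integrable_def
    by (subst nn_integral_eq_integral) auto
  finally show ?thesis by (simp add: a_def m_def)
next
  case False
  then have "(\<integral>\<^sup>+x. ennreal (indicator Q x * (f x)\<^sup>2) \<partial>M) = \<infinity>"
    by (simp add: less_top[symmetric])
  then show ?thesis using pos by (simp add: ennreal_mult_top)
qed

text \<open>
  The deviation is the average over \<open>Q\<close> of \<open>u x - u y\<close>. By Jensen's inequality its square
  is at most the average of \<open>(u x - u y)\<^sup>2\<close>, and the Gagliardo kernel is at least \<open>d powr - (N + 2 s)\<close> on \<open>Q\<close>.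
\<close>

lemma deviation_from_average_le:
  fixes u :: "real ^ 'n \<Rightarrow> real"
  assumes [measurable]: "u \<in> borel_measurable borel" "Q \<in> sets borel"
    and fin: "emeasure lborel Q < \<infinity>" and pos: "0 < measure lborel Q"
    and int: "set_integrable lborel Q u"
    and near: "\<And>y. y \<in> Q \<Longrightarrow> norm (x - y) \<le> d" and s: "0 < s"
  shows "ennreal ((u x - (LINT y:Q|lborel. u y) / measure lborel Q)\<^sup>2)
    \<le> ennreal (d powr (real CARD('n) + 2 * s) / measure lborel Q) * frac_density s u x"
proof -
  define m where "m = measure lborel Q"
  define \<beta> where "\<beta> = real CARD('n) + 2 * s"
  have m: "m > 0" using pos by (simp add: m_def)
  have \<beta>: "\<beta> > 0" using s by (simp add: \<beta>_def add_nonneg_pos)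
  have one: "set_integrable lborel Q (\<lambda>y. u x)" and one_eq: "(LINT y:Q|lborel. u x) = u x * m"
    using fin by (auto simp: set_integrable_def set_lebesgue_integral_def m_def)
  have "(LINT y:Q|lborel. u x - u y) = u x * m - (LINT y:Q|lborel. u y)"
    using one int one_eq by (simp add: set_integral_diff)
  then have "u x - (LINT y:Q|lborel. u y) / m = (LINT y:Q|lborel. u x - u y) / m"
    using m by (simp add: field_simps)
  then have "ennreal ((u x - (LINT y:Q|lborel. u y) / m)\<^sup>2)
     \<le> ennreal (1 / m) * (\<integral>\<^sup>+y. ennreal (indicator Q y * (u x - u y)\<^sup>2) \<partial>lborel)"
    using square_average_le_average_square[of "\<lambda>y. u x - u y" lborel Q] fin pos
    by (simp add: m_def)
  also have "(\<integral>\<^sup>+y. ennreal (indicator Q y * (u x - u y)\<^sup>2) \<partial>lborel)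
      \<le> (\<integral>\<^sup>+y. ennreal (d powr \<beta>) * ennreal (\<bar>u x - u y\<bar>\<^sup>2 / norm (x - y) powr \<beta>) \<partial>lborel)"
  proof (intro nn_integral_mono)
    fix y
    show "ennreal (indicator Q y * (u x - u y)\<^sup>2)
       \<le> ennreal (d powr \<beta>) * ennreal (\<bar>u x - u y\<bar>\<^sup>2 / norm (x - y) powr \<beta>)"
    proof (cases "y \<in> Q \<and> x \<noteq> y")
      case True
      then have "norm (x - y) powr \<beta> \<le> d powr \<beta>" "norm (x - y) powr \<beta> > 0"
        using near \<beta> by (auto intro: powr_mono2)
      then have "(u x - u y)\<^sup>2 \<le> d powr \<beta> * (\<bar>u x - u y\<bar>\<^sup>2 / norm (x - y) powr \<beta>)"
        by (simp add: pos_le_divide_eq mult.commute[of _ "(u x - u y)\<^sup>2"] mult_left_mono)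
      then show ?thesis using True by (simp add: ennreal_mult'[symmetric] ennreal_leI)
    qed (auto simp: indicator_def)
  qed
  also have "\<dots> = ennreal (d powr \<beta>) * frac_density s u x"
    unfolding frac_density_def \<beta>_def by (rule nn_integral_cmult) auto
  finally show ?thesis
    using m by (simp add: m_def \<beta>_def mult.assoc[symmetric] ennreal_mult'[symmetric] mult_left_mono)
qed

section \<open>A fractional Gagliardo--Nirenberg inequality\<close>

lemma measurable_mem_ball [measurable]: "Measurable.pred borel (\<lambda>x. x \<in> ball a r)"
  for a :: "'a::metric_space"
  using borel_open[OF open_ball, of a r] by (simp add: pred_def ball_def)

lemma ball_volume:
  fixes x :: "'a::euclidean_space"
  assumes "0 \<le> r"
  shows "emeasure lborel (ball x r) = ennreal (r ^ DIM('a) * measure lborel (ball (0::'a) 1))"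
    and "measure lborel (ball x r) = r ^ DIM('a) * measure lborel (ball (0::'a) 1)"
proof -
  show "measure lborel (ball x r) = r ^ DIM('a) * measure lborel (ball (0::'a) 1)"
    using content_ball_conv_unit_ball[OF assms, of x] by simp
  then show "emeasure lborel (ball x r) = ennreal (r ^ DIM('a) * measure lborel (ball (0::'a) 1))"
    using emeasure_lborel_ball_finite[of x r] by (subst emeasure_eq_ennreal_measure) auto
qed

lemma set_integrable_if_mass_finite:
  fixes u :: "'a::euclidean_space \<Rightarrow> real"
  assumes [measurable]: "u \<in> borel_measurable borel" "Q \<in> sets borel"
    and "emeasure lborel Q < \<infinity>" "mass u < \<infinity>"
  shows "set_integrable lborel Q u"
proof -
  have "(\<integral>\<^sup>+x. ennreal (indicator Q x * (u x)\<^sup>2) \<partial>lborel) \<le> mass u"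
    unfolding mass_def by (intro nn_integral_mono) (auto simp: indicator_def)
  then show ?thesis
    using assms by (intro integrable_if_square_integrable_on_finite) (auto intro: le_less_trans)
qed

lemma square_average_le_mass:
  fixes u :: "'a::euclidean_space \<Rightarrow> real"
  assumes [measurable]: "u \<in> borel_measurable borel" "Q \<in> sets borel"
    and "emeasure lborel Q < \<infinity>" "0 < measure lborel Q"
  shows "ennreal (((LINT y:Q|lborel. u y) / measure lborel Q)\<^sup>2)
    \<le> ennreal (1 / measure lborel Q) * mass u"
proof -
  have "ennreal (((LINT y:Q|lborel. u y) / measure lborel Q)\<^sup>2)
      \<le> ennreal (1 / measure lborel Q) * (\<integral>\<^sup>+x. ennreal (indicator Q x * (u x)\<^sup>2) \<partial>lborel)"
    using assms by (intro square_average_le_average_square) auto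
  also have "\<dots> \<le> ennreal (1 / measure lborel Q) * mass u"
    unfolding mass_def by (intro mult_left_mono nn_integral_mono) (auto simp: indicator_def)
  finally show ?thesis .
qed

text \<open>
  The mass-critical inequality holds already before integration. Compare \<open>u x\<close> with its average over
  a ball of radius \<open>r\<close>: the average is at most \<open>sqrt (m / \<bar>ball\<bar>)\<close> in modulus and the deviation is at most
  a multiple of \<open>r powr s * sqrt (frac_density s u x)\<close>. The radius is chosen just large
  enough, depending on \<open>u x\<close>, for the average to be at most half of \<open>u x\<close>; the deviation accounts for the
  other half.
\<close>

lemma critical_power_pointwise:
  fixes u :: "real ^ 'n \<Rightarrow> real"
  assumes u[measurable]: "u \<in> borel_measurable borel" and s: "0 < s"
    and m: "mass u = ennreal m" "0 < m"
  shows "ennreal (\<bar>u x\<bar> powr (2 + 4 * s / real CARD('n)))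
    \<le> ennreal ((4 / measure lborel (ball (0::real ^ 'n) 1)) powr (1 + 2 * s / real CARD('n)) * m powr (2 * s / real CARD('n)))
      * frac_density s u x"
proof -
  define V where "V = measure lborel (ball (0::real ^ 'n) 1)"
  define N where "N = real CARD('n)"
  have V: "V > 0" unfolding V_def by (rule content_ball_pos) simp
  have N: "N > 0" by (simp add: N_def)
  define K where "K = (4 / V) powr (1 + 2 * s / N) * m powr (2 * s / N)"
  have K: "K > 0" using V m by (simp add: K_def)
  have "ennreal (\<bar>u x\<bar> powr (2 + 4 * s / N)) \<le> ennreal K * frac_density s u x"
  proof (cases "u x = 0 \<or> frac_density s u x = \<infinity>")
    case True
    then show ?thesis using K by (auto simp: ennreal_mult_top)
  next
    case False
    define g where "g = enn2real (frac_density s u x)"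
    have g: "frac_density s u x = ennreal g" "g \<ge> 0"
      using False by (auto simp: g_def less_top[symmetric])
    define t where "t = \<bar>u x\<bar>"
    have t: "t > 0" using False by (simp add: t_def)
    \<comment> \<open>With this radius the ball has volume \<open>4 * m / t\<^sup>2\<close>, so the average is at most
      \<open>t / 2\<close> in modulus.\<close>
    define r where "r = (4 * m / (V * t\<^sup>2)) powr (1 / N)"
    have r: "r > 0" using m t V by (simp add: r_def)
    have "r ^ CARD('n) = r powr N" using r by (simp add: N_def powr_realpow)
    also have "\<dots> = 4 * m / (V * t\<^sup>2)" using N V m t by (simp add: r_def powr_powr)
    finally have rN: "r ^ CARD('n) = 4 * m / (V * t\<^sup>2)" .
    define W where "W = measure lborel (ball x r)"
    have W: "W = r ^ CARD('n) * V" using ball_volume(2)[of r x] r by (simp add: W_def V_def)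
    then have W': "W = 4 * m / t\<^sup>2" using rN V t m by (simp add: field_simps)
    then have W0: "W > 0" using m t by simp
    have fin: "emeasure lborel (ball x r) < \<infinity>" by (rule emeasure_lborel_ball_finite)
    define a where "a = (LINT y:ball x r|lborel. u y) / W"
    have "ennreal (a\<^sup>2) \<le> ennreal (1 / W) * mass u"
      unfolding a_def W_def using fin W' W0 by (intro square_average_le_mass) (auto simp: W_def)
    then have "ennreal (a\<^sup>2) \<le> ennreal (m / W)"
      using m W' W0 by (simp add: ennreal_mult'[symmetric])
    then have a: "a\<^sup>2 \<le> m / W" using m W' W0 by (simp add: ennreal_le_iff)
    have "ennreal ((u x - a)\<^sup>2) \<le> ennreal (r powr (N + 2 * s) / W) * frac_density s u x"
      unfolding a_def W_def N_def using fin W' W0 s m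
      by (intro deviation_from_average_le set_integrable_if_mass_finite)
         (auto simp: W_def dist_norm norm_minus_commute)
    then have "ennreal ((u x - a)\<^sup>2) \<le> ennreal (r powr (N + 2 * s) / W * g)"
      using g W0 by (simp add: ennreal_mult'[symmetric])
    then have d: "(u x - a)\<^sup>2 \<le> r powr (N + 2 * s) / W * g"
      using g W0 by (subst (asm) ennreal_le_iff) auto
    have "t\<^sup>2 = (u x)\<^sup>2" by (simp add: t_def)
    also have "\<dots> \<le> 2 * (u x - a)\<^sup>2 + 2 * a\<^sup>2"
      using zero_le_power2[of "u x - 2 * a"] by (simp add: power2_eq_square algebra_simps)
    also have "\<dots> \<le> 2 * (r powr (N + 2 * s) / W * g) + 2 * (m / W)" using a d by linarith
    also have "2 * (m / W) = t\<^sup>2 / 2" using W' W0 m t by (simp add: field_simps)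
    also have "r powr (N + 2 * s) / W = r powr (2 * s) / V"
      using r W V by (simp add: powr_add N_def powr_realpow)
    also have "r powr (2 * s) = (4 / V) powr (2 * s / N) * m powr (2 * s / N) / t powr (4 * s / N)"
    proof -
      have "r powr (2 * s) = (4 / V * m / t powr 2) powr (2 * s / N)"
        using t by (simp add: r_def powr_powr powr_numeral field_simps)
      also have "\<dots> = (4 / V) powr (2 * s / N) * m powr (2 * s / N) / t powr (4 * s / N)"
        using V m t by (simp add: powr_divide powr_mult powr_powr del: powr_numeral)
      finally show ?thesis .
    qed
    finally have "t\<^sup>2 \<le> 4 * ((4 / V) powr (2 * s / N) * m powr (2 * s / N) / t powr (4 * s / N) / V * g)"
      by linarith
    also have "\<dots> = K * g / t powr (4 * s / N)"
      using V by (simp add: K_def powr_add mult_ac)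
    finally have "t\<^sup>2 * t powr (4 * s / N) \<le> K * g"
      using t by (simp add: pos_le_divide_eq)
    moreover have "t\<^sup>2 * t powr (4 * s / N) = t powr (2 + 4 * s / N)"
      using t by (simp add: powr_add powr_numeral)
    ultimately show ?thesis
      using g K by (simp add: t_def ennreal_mult'[symmetric] ennreal_leI)
  qed
  then show ?thesis by (simp add: K_def N_def V_def)
qed

lemma mass_zero_imp_AE_zero:
  fixes u :: "'a::euclidean_space \<Rightarrow> real"
  assumes [measurable]: "u \<in> borel_measurable borel" and "mass u = 0"
  shows "AE x in lborel. u x = 0"
  using assms(2) unfolding mass_def by (subst (asm) nn_integral_0_iff_AE) auto

lemma critical_gagliardo_nirenberg:
  "\<exists>K>0. \<forall>(u :: real ^ 'n \<Rightarrow> real) m. u \<in> borel_measurable borel \<longrightarrow> mass u = ennreal m \<longrightarrow> 0 \<le> m \<longrightarrow>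
     power_integral (2 + 4 * s / real CARD('n)) u
       \<le> ennreal (K * m powr (2 * s / real CARD('n))) * gagliardo s u" if s: "0 < s"
proof (intro exI[of _ "(4 / measure lborel (ball (0::real ^ 'n) 1)) powr (1 + 2 * s / real CARD('n))"] conjI allI impI)
  show "0 < (4 / measure lborel (ball (0::real ^ 'n) 1)) powr (1 + 2 * s / real CARD('n))"
    using content_ball_pos[of 1 "0::real ^ 'n"] by simp
next
  fix u :: "real ^ 'n \<Rightarrow> real" and m
  assume u[measurable]: "u \<in> borel_measurable borel" and m: "mass u = ennreal m" "0 \<le> m"
  let ?c = "(4 / measure lborel (ball (0::real ^ 'n) 1)) powr (1 + 2 * s / real CARD('n)) * m powr (2 * s / real CARD('n))"
  show "power_integral (2 + 4 * s / real CARD('n)) u \<le> ennreal ?c * gagliardo s u"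
  proof (cases "m = 0")
    case True
    have "power_integral (2 + 4 * s / real CARD('n)) u = power_integral (2 + 4 * s / real CARD('n)) (\<lambda>x::real ^ 'n. 0)"
      using mass_zero_imp_AE_zero[OF u] m True by (intro power_integral_cong_AE) auto
    then show ?thesis by (simp add: power_integral_def)
  next
    case False
    then have "power_integral (2 + 4 * s / real CARD('n)) u
        \<le> (\<integral>\<^sup>+x. ennreal ?c * frac_density s u x \<partial>lborel)"
      unfolding power_integral_def using s m by (intro nn_integral_mono critical_power_pointwise) auto
    also have "\<dots> = ennreal ?c * gagliardo s u"
      unfolding gagliardo_eq_integral_density by (rule nn_integral_cmult) simp
    finally show ?thesis .
  qed
qed

text \<open>
  Below the level \<open>M\<close> the power \<open>p\<close> is dominated by the square, above it by the power \<open>q\<close>.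
\<close>

lemma power_le_interpolation:
  fixes t :: real
  assumes "0 < M" "2 \<le> p" "p \<le> q"
  shows "\<bar>t\<bar> powr p \<le> M powr (p - 2) * t\<^sup>2 + M powr (p - q) * \<bar>t\<bar> powr q"
proof (cases "t = 0")
  case False
  then have t: "\<bar>t\<bar> > 0" by simp
  show ?thesis
  proof (cases "\<bar>t\<bar> \<le> M")
    case True
    have "\<bar>t\<bar> powr p = \<bar>t\<bar> powr (p - 2) * t\<^sup>2"
      using t by (simp add: powr_diff powr_numeral)
    also have "\<dots> \<le> M powr (p - 2) * t\<^sup>2"
      using True assms by (intro mult_right_mono powr_mono2) auto
    finally show ?thesis by (simp add: add_increasing2)
  next
    case False
    have "\<bar>t\<bar> powr p = \<bar>t\<bar> powr (p - q) * \<bar>t\<bar> powr q"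
      using t by (simp add: powr_add[symmetric])
    also have "\<dots> \<le> M powr (p - q) * \<bar>t\<bar> powr q"
      using False assms by (intro mult_right_mono powr_mono2') auto
    finally show ?thesis by (simp add: add_increasing)
  qed
qed (use assms in auto)

text \<open>
  The level \<open>M\<close> is left free: a large \<open>M\<close> makes the coefficient of the energy small, which gives
  coercivity, while \<open>M = 1\<close> bounds the power integral of a difference by its mass when the energy
  stays bounded.
\<close>

lemma subcritical_gagliardo_nirenberg:
  "\<exists>K>0. \<forall>(u :: real ^ 'n \<Rightarrow> real) m M p. u \<in> borel_measurable borel \<longrightarrow> mass u = ennreal m \<longrightarrow> 0 \<le> m \<longrightarrow>
     0 < M \<longrightarrow> 2 \<le> p \<longrightarrow> p \<le> 2 + 4 * s / real CARD('n) \<longrightarrow>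
     power_integral p u \<le> ennreal (M powr (p - 2) * m)
       + ennreal (M powr (p - (2 + 4 * s / real CARD('n))) * (K * m powr (2 * s / real CARD('n)))) * gagliardo s u"
  if s: "0 < s"
proof -
  obtain K where K: "K > 0" and GN: "\<And>(u :: real ^ 'n \<Rightarrow> real) m. u \<in> borel_measurable borel \<Longrightarrow> mass u = ennreal m \<Longrightarrow> 0 \<le> m \<Longrightarrow>
     power_integral (2 + 4 * s / real CARD('n)) u
       \<le> ennreal (K * m powr (2 * s / real CARD('n))) * gagliardo s u"
    using critical_gagliardo_nirenberg[OF s] by blast
  define q where "q = 2 + 4 * s / real CARD('n)"
  show ?thesis
  proof (intro exI[of _ K] conjI K allI impI)
    fix u :: "real ^ 'n \<Rightarrow> real" and m M p :: real
    assume u[measurable]: "u \<in> borel_measurable borel" and m: "mass u = ennreal m" "0 \<le> m"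
      and M: "0 < M" and p: "2 \<le> p" "p \<le> 2 + 4 * s / real CARD('n)"
    have "power_integral p u
        \<le> (\<integral>\<^sup>+x. ennreal (M powr (p - 2)) * ennreal ((u x)\<^sup>2)
              + ennreal (M powr (p - q)) * ennreal (\<bar>u x\<bar> powr q) \<partial>lborel)"
      unfolding power_integral_def using power_le_interpolation[OF M, of p q] p
      by (intro nn_integral_mono)
         (simp add: q_def ennreal_mult'[symmetric] ennreal_plus[symmetric] ennreal_leI del: ennreal_plus)
    also have "\<dots> = ennreal (M powr (p - 2)) * mass u + ennreal (M powr (p - q)) * power_integral q u"
      unfolding mass_def power_integral_def
      by (simp add: nn_integral_add nn_integral_cmult)
    also have "\<dots> \<le> ennreal (M powr (p - 2)) * ennreal m
       + ennreal (M powr (p - q)) * (ennreal (K * m powr (2 * s / real CARD('n))) * gagliardo s u)"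
      using GN[OF u m] m by (intro add_mono mult_left_mono) (auto simp: q_def)
    finally show "power_integral p u \<le> ennreal (M powr (p - 2) * m)
       + ennreal (M powr (p - (2 + 4 * s / real CARD('n))) * (K * m powr (2 * s / real CARD('n)))) * gagliardo s u"
      using K by (simp add: q_def ennreal_mult' mult.assoc)
  qed
qed

section \<open>The constraint set is nonempty\<close>

lemma nn_integral_lborel_translate:
  fixes f :: "'a::euclidean_space \<Rightarrow> ennreal"
  assumes [measurable]: "f \<in> borel_measurable borel"
  shows "(\<integral>\<^sup>+x. f (a + x) \<partial>lborel) = (\<integral>\<^sup>+x. f x \<partial>lborel)"
proof -
  have "(\<integral>\<^sup>+x. f x \<partial>lborel) = (\<integral>\<^sup>+x. f x \<partial>distr lborel borel ((+) a))"
    by (simp add: lborel_distr_plus)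
  then show ?thesis by (simp add: nn_integral_distr)
qed

lemma nn_integral_lborel_uminus:
  fixes f :: "'a::euclidean_space \<Rightarrow> ennreal"
  assumes [measurable]: "f \<in> borel_measurable borel"
  shows "(\<integral>\<^sup>+x. f (- x) \<partial>lborel) = (\<integral>\<^sup>+x. f x \<partial>lborel)"
proof -
  have "lborel = distr lborel borel (uminus :: 'a \<Rightarrow> 'a)"
    using lborel_affine[of "-1" "0::'a"] by (simp add: density_1)
  then have "(\<integral>\<^sup>+x. f x \<partial>lborel) = (\<integral>\<^sup>+x. f x \<partial>distr lborel borel uminus)"
    by simp
  then show ?thesis by (simp add: nn_integral_distr)
qed

lemma nn_integral_lborel_minus:
  fixes f :: "'a::euclidean_space \<Rightarrow> ennreal"
  assumes [measurable]: "f \<in> borel_measurable borel"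
  shows "(\<integral>\<^sup>+y. f (a - y) \<partial>lborel) = (\<integral>\<^sup>+y. f y \<partial>lborel)"
    and "(\<integral>\<^sup>+y. f (y - a) \<partial>lborel) = (\<integral>\<^sup>+y. f y \<partial>lborel)"
  using nn_integral_lborel_uminus[of "\<lambda>y. f (a + y)"] nn_integral_lborel_translate[of f a]
    nn_integral_lborel_translate[of f "- a"] by simp_all

lemma ex_dyadic_bracket:
  fixes t :: real
  assumes "1 \<le> t"
  shows "\<exists>k. 2 ^ k \<le> t \<and> t < 2 ^ Suc k"
proof -
  have ex: "\<exists>n. t < 2 ^ n" using real_arch_pow[of 2 t] by simp
  define n where "n = (LEAST n. t < 2 ^ n)"
  have n: "t < 2 ^ n" unfolding n_def using ex by (rule LeastI_ex)
  then have "n \<noteq> 0" using assms by (intro notI) simp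
  then obtain k where k: "n = Suc k" by (cases n) auto
  have "\<not> t < 2 ^ k" using not_less_Least[of k "\<lambda>n. t < 2 ^ n"] k by (simp add: n_def)
  then show ?thesis using n k by (intro exI[of _ k]) simp
qed

lemma ennreal_term_le_suminf: "f k \<le> (\<Sum>k. f k)" for f :: "nat \<Rightarrow> ennreal"
  using sum_le_suminf[of f "{k}"] by simp

text \<open>
  The integrand is cut into dyadic annuli. The contribution of the annulus of radius \<open>2 ^ - k\<close> is of
  order \<open>2 powr (k * (2 * s - 2))\<close> and that of radius \<open>2 ^ k\<close> of order \<open>2 powr (- 2 * k * s)\<close>; both
  geometric series converge because \<open>0 < s < 1\<close>.
\<close>

lemma truncated_kernel_integral_finite:
  assumes s: "0 < s" "s < 1"
  shows "(\<integral>\<^sup>+z. ennreal (min 1 ((norm z)\<^sup>2) / norm z powr (real CARD('n) + 2 * s)) \<partial>(lborel :: (real ^ 'n) measure)) < \<infinity>"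
proof -
  define N where "N = real CARD('n)"
  define \<beta> where "\<beta> = N + 2 * s"
  define V where "V = measure lborel (ball (0::real ^ 'n) 1)"
  have V: "V > 0" unfolding V_def by (rule content_ball_pos) simp
  have \<beta>: "\<beta> > 0" using s by (simp add: \<beta>_def N_def add_nonneg_pos)
  define A where "A = (\<lambda>k (z::real ^ 'n). ennreal ((1/4) ^ k * (2 ^ Suc k) powr \<beta>) * indicator (ball 0 (2 * (1/2) ^ k)) z)"
  define B where "B = (\<lambda>k (z::real ^ 'n). ennreal (1 / (2 ^ k) powr \<beta>) * indicator (ball 0 (2 ^ Suc k)) z)"
  have [measurable]: "A k \<in> borel_measurable borel" "B k \<in> borel_measurable borel" for k
    unfolding A_def B_def by measurable
  have bound: "ennreal (min 1 ((norm z)\<^sup>2) / norm z powr \<beta>) \<le> (\<Sum>k. A k z) + (\<Sum>k. B k z)" for z :: "real ^ 'n"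
  proof (cases "z = 0")
    case False
    then have z: "norm z > 0" by simp
    show ?thesis
    proof (cases "norm z \<ge> 1")
      case True
      then obtain k where k: "2 ^ k \<le> norm z" "norm z < 2 ^ Suc k" using ex_dyadic_bracket by blast
      have "1 / norm z powr \<beta> \<le> 1 / (2 ^ k) powr \<beta>"
        using k \<beta> z by (intro divide_left_mono powr_mono2 mult_pos_pos) auto
      moreover have "min 1 ((norm z)\<^sup>2) = 1" using True by (simp add: min_def)
      ultimately have "ennreal (min 1 ((norm z)\<^sup>2) / norm z powr \<beta>) \<le> B k z"
        using k by (simp add: B_def ennreal_leI)
      also have "\<dots> \<le> (\<Sum>k. B k z)" by (rule ennreal_term_le_suminf)
      finally show ?thesis by (simp add: add_increasing)
    next
      case False
      then have "1 \<le> 1 / norm z" using z by simp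
      then obtain k where k: "2 ^ k \<le> 1 / norm z" "1 / norm z < 2 ^ Suc k" using ex_dyadic_bracket by blast
      have k1: "norm z \<le> (1/2) ^ k" using k(1) z by (simp add: field_simps power_one_over)
      have k2: "1 / 2 ^ Suc k < norm z" using k(2) z by (simp add: field_simps)
      have sq: "(norm z)\<^sup>2 \<le> (1/4) ^ k"
        using power_mono[OF k1, of 2] by (simp add: power_mult[symmetric] power_even_eq power2_eq_square flip: power_mult_distrib)
      have "1 / norm z powr \<beta> = (1 / norm z) powr \<beta>" using z by (simp add: powr_divide)
      also have "\<dots> \<le> (2 ^ Suc k) powr \<beta>" using k(2) \<beta> z by (intro powr_mono2) auto
      finally have "(norm z)\<^sup>2 * (1 / norm z powr \<beta>) \<le> (1/4) ^ k * (2 ^ Suc k) powr \<beta>"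
        using sq by (intro mult_mono) auto
      moreover have "min 1 ((norm z)\<^sup>2) = (norm z)\<^sup>2" using False power_le_one[of "norm z" 2] by (simp add: min_def)
      moreover have "z \<in> ball 0 (2 * (1/2) ^ k)"
        using k1 by (simp add: le_less_trans[OF k1])
      ultimately have "ennreal (min 1 ((norm z)\<^sup>2) / norm z powr \<beta>) \<le> A k z"
        by (simp add: A_def ennreal_leI)
      also have "\<dots> \<le> (\<Sum>k. A k z)" by (rule ennreal_term_le_suminf)
      finally show ?thesis by (simp add: add_increasing2)
    qed
  qed simp
  have power_powr: "(2 ^ k) powr \<beta> = (2 powr \<beta>) ^ k" for k :: nat
    by (simp add: powr_powr powr_power flip: powr_realpow) (simp add: mult.commute)
  define qA where "qA = (1/4) * 2 powr \<beta> * (1/2) ^ CARD('n)"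
  define qB where "qB = 2 ^ CARD('n) / 2 powr \<beta>"
  have intA: "(\<integral>\<^sup>+z. A k z \<partial>lborel) = ennreal (2 powr \<beta> * 2 ^ CARD('n) * V * qA ^ k)" for k
  proof -
    have "(\<integral>\<^sup>+z. A k z \<partial>lborel) = ennreal ((1/4) ^ k * (2 ^ Suc k) powr \<beta>) * emeasure lborel (ball (0::real ^ 'n) (2 * (1/2) ^ k))"
      unfolding A_def by (rule nn_integral_cmult_indicator) simp
    also have "\<dots> = ennreal ((1/4) ^ k * (2 ^ Suc k) powr \<beta> * ((2 * (1/2) ^ k) ^ CARD('n) * V))"
      unfolding V_def by (subst ball_volume(1), simp, subst ennreal_mult'[symmetric]) simp_all
    also have "(1/4) ^ k * (2 ^ Suc k) powr \<beta> * ((2 * (1/2) ^ k) ^ CARD('n) * V)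
        = 2 powr \<beta> * 2 ^ CARD('n) * V * qA ^ k"
      unfolding power_powr qA_def power_mult_distrib power_mult[symmetric] mult.commute[of k] by simp
    finally show ?thesis .
  qed
  have intB: "(\<integral>\<^sup>+z. B k z \<partial>lborel) = ennreal (2 ^ CARD('n) * V * qB ^ k)" for k
  proof -
    have "(\<integral>\<^sup>+z. B k z \<partial>lborel) = ennreal (1 / (2 ^ k) powr \<beta>) * emeasure lborel (ball (0::real ^ 'n) (2 ^ Suc k))"
      unfolding B_def by (rule nn_integral_cmult_indicator) simp
    also have "\<dots> = ennreal (1 / (2 ^ k) powr \<beta> * ((2 ^ Suc k) ^ CARD('n) * V))"
      unfolding V_def by (subst ball_volume(1), simp, subst ennreal_mult'[symmetric]) simp_all
    also have "1 / (2 ^ k) powr \<beta> * ((2 ^ Suc k) ^ CARD('n) * V) = 2 ^ CARD('n) * V * qB ^ k"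
      unfolding power_powr qB_def power_divide power_Suc power_mult_distrib power_mult[symmetric] mult.commute[of k]
      by simp
    finally show ?thesis .
  qed
  have geom: "(\<Sum>k. ennreal (c * q ^ k)) < top" if "0 \<le> c" "0 < q" "q < 1" for c q :: real
    using that by (subst suminf_ennreal2) (auto intro!: summable_mult summable_geometric)
  have "2 powr \<beta> = 2 ^ CARD('n) * 2 powr (2 * s)"
    by (simp add: \<beta>_def N_def powr_add powr_realpow)
  moreover have "2 powr (2 * s) < (4::real)" "1 < 2 powr (2 * s)"
    using s powr_less_mono[of "2 * s" 2 "2::real"] powr_less_mono[of 0 "2 * s" "2::real"] by auto
  ultimately have q: "0 < qA" "qA < 1" "0 < qB" "qB < 1"
    by (auto simp: qA_def qB_def power_one_over field_simps)
  have "(\<integral>\<^sup>+z. ennreal (min 1 ((norm z)\<^sup>2) / norm z powr \<beta>) \<partial>(lborel :: (real ^ 'n) measure))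
      \<le> (\<integral>\<^sup>+z. (\<Sum>k. A k z) + (\<Sum>k. B k z) \<partial>lborel)"
    by (intro nn_integral_mono bound)
  also have "\<dots> = (\<Sum>k. \<integral>\<^sup>+z. A k z \<partial>lborel) + (\<Sum>k. \<integral>\<^sup>+z. B k z \<partial>lborel)"
    by (simp add: nn_integral_add nn_integral_suminf)
  also have "\<dots> < \<infinity>"
    unfolding intA intB using q V by (auto intro!: geom)
  finally show ?thesis by (simp add: \<beta>_def N_def)
qed

definition tent :: "'a::euclidean_space \<Rightarrow> real" where
  "tent x = max 0 (1 - norm x)"

lemma tent_measurable [measurable]: "tent \<in> borel_measurable borel"
  unfolding tent_def[abs_def] by measurable

lemma tent_square_le: "(tent x)\<^sup>2 \<le> indicator (ball 0 1) x"
  by (auto simp: tent_def indicator_def power_le_one)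

text \<open>
  A tent is Lipschitz, bounded and supported in the unit ball, so its difference quotient is
  dominated by the truncated kernel as soon as one of the two points lies in that ball.
\<close>

lemma gagliardo_tent_finite:
  assumes s: "0 < s" "s < 1"
  shows "gagliardo s (tent :: real ^ 'n \<Rightarrow> real) < \<infinity>"
proof -
  define h where "h = (\<lambda>z::real ^ 'n. ennreal (min 1 ((norm z)\<^sup>2) / norm z powr (real CARD('n) + 2 * s)))"
  define b where "b = (indicator (ball (0::real ^ 'n) 1) :: real ^ 'n \<Rightarrow> ennreal)"
  have [measurable]: "h \<in> borel_measurable borel" "b \<in> borel_measurable borel"
    unfolding h_def b_def by measurable
  have bound: "ennreal (\<bar>tent x - tent y\<bar>\<^sup>2 / norm (x - y) powr (real CARD('n) + 2 * s))
      \<le> b x * h (x - y) + b y * h (x - y)" for x y :: "real ^ 'n"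
  proof (cases "norm x < 1 \<or> norm y < 1")
    case True
    have "\<bar>tent x - tent y\<bar> \<le> norm (x - y)" "\<bar>tent x - tent y\<bar> \<le> 1"
      using norm_triangle_ineq3[of x y] norm_ge_zero[of x] norm_ge_zero[of y]
      unfolding tent_def max_def by (smt (verit))+
    then have "\<bar>tent x - tent y\<bar>\<^sup>2 \<le> min 1 ((norm (x - y))\<^sup>2)"
      using power_mono[of "\<bar>tent x - tent y\<bar>" _ 2] by (force simp: power_le_one)
    then have "ennreal (\<bar>tent x - tent y\<bar>\<^sup>2 / norm (x - y) powr (real CARD('n) + 2 * s)) \<le> h (x - y)"
      unfolding h_def by (intro ennreal_leI divide_right_mono) auto
    also have "\<dots> \<le> b x * h (x - y) + b y * h (x - y)"
      using True by (auto simp: b_def indicator_def)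
    finally show ?thesis .
  qed (auto simp: tent_def)
  have "gagliardo s (tent :: real ^ 'n \<Rightarrow> real)
      \<le> (\<integral>\<^sup>+x. \<integral>\<^sup>+y. b x * h (x - y) + b y * h (x - y) \<partial>lborel \<partial>lborel)"
    unfolding gagliardo_eq_integral_density frac_density_def by (intro nn_integral_mono bound)
  also have "\<dots> = (\<integral>\<^sup>+x. \<integral>\<^sup>+y. b x * h (x - y) \<partial>lborel \<partial>lborel) + (\<integral>\<^sup>+x. \<integral>\<^sup>+y. b y * h (x - y) \<partial>lborel \<partial>lborel)"
    by (simp add: nn_integral_add)
  also have "(\<integral>\<^sup>+x. \<integral>\<^sup>+y. b y * h (x - y) \<partial>lborel \<partial>lborel) = (\<integral>\<^sup>+y. \<integral>\<^sup>+x. b y * h (x - y) \<partial>lborel \<partial>lborel)"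
    by (rule lborel_pair.Fubini') simp
  also have "(\<integral>\<^sup>+x. \<integral>\<^sup>+y. b x * h (x - y) \<partial>lborel \<partial>lborel) + \<dots>
      = 2 * (emeasure lborel (ball (0::real ^ 'n) 1) * (\<integral>\<^sup>+z. h z \<partial>lborel))"
    by (simp add: nn_integral_cmult nn_integral_multc nn_integral_lborel_minus b_def mult_2)
  also have "\<dots> < \<infinity>"
    using truncated_kernel_integral_finite[OF s, where ?'n = 'n] emeasure_lborel_ball_finite[of "0::real ^ 'n" 1]
    by (auto simp: h_def ennreal_mult_less_top)
  finally show ?thesis .
qed

lemma gagliardo_scale: "gagliardo s (\<lambda>x. a * u x) = ennreal (a\<^sup>2) * gagliardo s u"
  if [measurable]: "u \<in> borel_measurable borel" for u :: "real ^ 'n \<Rightarrow> real"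
proof -
  have "frac_density s (\<lambda>x. a * u x) x = ennreal (a\<^sup>2) * frac_density s u x" for x
  proof -
    have "\<bar>a * u x - a * u y\<bar>\<^sup>2 = a\<^sup>2 * \<bar>u x - u y\<bar>\<^sup>2" for y
      by (simp flip: right_diff_distrib add: power_mult_distrib)
    then show ?thesis
      unfolding frac_density_def
      by (subst nn_integral_cmult[symmetric]) (simp_all flip: ennreal_mult' times_divide_eq_right)
  qed
  then have "frac_density s (\<lambda>x. a * u x) = (\<lambda>x. ennreal (a\<^sup>2) * frac_density s u x)"
    by (intro ext)
  then show ?thesis
    unfolding gagliardo_eq_integral_density by (simp add: nn_integral_cmult)
qed

lemma S_constraint_nonempty:
  assumes s: "0 < s" "s < 1"
  shows "(S_constraint C s c :: (real ^ 'n \<Rightarrow> real) set) \<noteq> {}"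
proof -
  let ?B = "ball (0::real ^ 'n) 1"
  have fin: "mass (tent :: real ^ 'n \<Rightarrow> real) < \<infinity>"
  proof -
    have "mass (tent :: real ^ 'n \<Rightarrow> real) \<le> (\<integral>\<^sup>+x. ennreal (indicator ?B x) \<partial>lborel)"
      unfolding mass_def by (intro nn_integral_mono ennreal_leI tent_square_le)
    also have "\<dots> < \<infinity>" using emeasure_lborel_ball_finite by (simp add: ennreal_indicator)
    finally show ?thesis .
  qed
  have pos: "mass (tent :: real ^ 'n \<Rightarrow> real) \<noteq> 0"
  proof
    assume "mass (tent :: real ^ 'n \<Rightarrow> real) = 0"
    then have "AE x::real ^ 'n in lborel. tent x = 0" by (intro mass_zero_imp_AE_zero) auto
    then have "AE x::real ^ 'n in lborel. x \<notin> ?B" by eventually_elim (auto simp: tent_def)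
    then have "emeasure lborel ?B = 0" by (subst (asm) AE_iff_measurable[where N = ?B]) auto
    then show False using ball_volume(1)[of 1 "0::real ^ 'n"] content_ball_pos[of 1 "0::real ^ 'n"] by simp
  qed
  define m where "m = enn2real (mass (tent :: real ^ 'n \<Rightarrow> real))"
  have m: "mass (tent :: real ^ 'n \<Rightarrow> real) = ennreal m" "m > 0"
    using fin pos by (auto simp: m_def enn2real_positive_iff less_top zero_less_iff_neq_zero)
  define a where "a = c / sqrt m"
  let ?u = "\<lambda>x::real ^ 'n. a * tent x"
  have a: "a\<^sup>2 * m = c\<^sup>2" using m by (simp add: a_def power_divide)
  have "mass ?u = ennreal (a\<^sup>2) * mass (tent :: real ^ 'n \<Rightarrow> real)"
    unfolding mass_def by (subst nn_integral_cmult[symmetric]) (auto simp: ennreal_mult'[symmetric] power_mult_distrib)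
  then have mu: "mass ?u = ennreal (c\<^sup>2)" using a m by (simp add: ennreal_mult'[symmetric])
  have "moment ?u \<le> mass ?u"
    unfolding moment_def mass_def
    by (intro nn_integral_mono ennreal_leI) (auto simp: tent_def max_def intro!: mult_left_le_one_le power_le_one)
  then have "moment ?u < \<infinity>" using mu by (auto intro: le_less_trans)
  moreover have "gagliardo s ?u < \<infinity>"
    using gagliardo_tent_finite[OF s, where ?'n = 'n] by (simp add: gagliardo_scale ennreal_mult_less_top)
  moreover have "?u \<in> borel_measurable lebesgue"
    by (intro measurable_completion) simp
  ultimately have "?u \<in> S_constraint C s c" using mu by (simp add: S_constraint_iff)
  then show ?thesis by blast
qed

section \<open>Completeness of the space of square integrable functions\<close>

lemma ennreal_tendsto_0_if_le:
  fixes f g :: "nat \<Rightarrow> ennreal"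
  assumes "\<And>n. f n \<le> g n" "g \<longlonglongrightarrow> 0"
  shows "f \<longlonglongrightarrow> 0"
  using assms by (intro tendsto_sandwich[OF _ _ tendsto_const assms(2)] always_eventually allI) simp_all

lemma nn_integral_le_if_AE_limit:
  fixes F :: "nat \<Rightarrow> 'a \<Rightarrow> ennreal"
  assumes [measurable]: "\<And>n. F n \<in> borel_measurable M"
    and lim: "AE x in M. (\<lambda>n. F n x) \<longlonglongrightarrow> G x"
    and le: "eventually (\<lambda>n. (\<integral>\<^sup>+x. F n x \<partial>M) \<le> c) sequentially"
  shows "(\<integral>\<^sup>+x. G x \<partial>M) \<le> c"
proof -
  have "(\<integral>\<^sup>+x. G x \<partial>M) = (\<integral>\<^sup>+x. liminf (\<lambda>n. F n x) \<partial>M)"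
    using lim by (intro nn_integral_cong_AE, eventually_elim) (simp add: lim_imp_Liminf)
  also have "\<dots> \<le> liminf (\<lambda>n. \<integral>\<^sup>+x. F n x \<partial>M)"
    by (rule nn_integral_liminf) simp
  also have "\<dots> \<le> limsup (\<lambda>n. \<integral>\<^sup>+x. F n x \<partial>M)"
    by (rule Liminf_le_Limsup) simp
  also have "\<dots> \<le> c" using le by (rule Limsup_bounded)
  finally show ?thesis .
qed

text \<open>
  This is the Riesz--Fischer argument. Along a subsequence with increments \<open>d k\<close> of squared norm at most
  \<open>(1/4) ^ k\<close>, the weighted sum of the \<open>2 ^ k * (d k x)\<^sup>2\<close> has finite integral; hence \<open>\<bar>d k x\<bar>\<close> decays
  geometrically for almost every \<open>x\<close>, and the subsequence converges there.
\<close>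

lemma L2_Cauchy_imp_convergent_subsequence:
  fixes f :: "nat \<Rightarrow> 'a \<Rightarrow> real"
  assumes f[measurable]: "\<And>n. f n \<in> borel_measurable M"
    and Cauchy: "\<And>e. 0 < e \<Longrightarrow> \<exists>n0. \<forall>n\<ge>n0. \<forall>m\<ge>n0. (\<integral>\<^sup>+x. ennreal ((f n x - f m x)\<^sup>2) \<partial>M) \<le> ennreal e"
  obtains r g where "strict_mono (r :: nat \<Rightarrow> nat)" "g \<in> borel_measurable M"
    "AE x in M. (\<lambda>n. f (r n) x) \<longlonglongrightarrow> g x"
    "(\<lambda>n. \<integral>\<^sup>+x. ennreal ((f (r n) x - g x)\<^sup>2) \<partial>M) \<longlonglongrightarrow> 0"
proof -
  have "\<forall>k::nat. \<exists>n0. \<forall>n\<ge>n0. \<forall>m\<ge>n0. (\<integral>\<^sup>+x. ennreal ((f n x - f m x)\<^sup>2) \<partial>M) \<le> ennreal ((1/4) ^ k)"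
    using Cauchy by simp
  then obtain N where N: "\<And>k n m. n \<ge> N k \<Longrightarrow> m \<ge> N k \<Longrightarrow>
      (\<integral>\<^sup>+x. ennreal ((f n x - f m x)\<^sup>2) \<partial>M) \<le> ennreal ((1/4) ^ k)"
    by metis
  define r where "r = rec_nat (N 0) (\<lambda>k m. max (Suc m) (N (Suc k)))"
  have r_Suc: "r (Suc k) = max (Suc (r k)) (N (Suc k))" for k by (simp add: r_def)
  have r: "strict_mono r" by (intro strict_monoI_Suc) (simp add: r_Suc)
  have rN: "r k \<ge> N k" for k by (cases k) (auto simp: r_Suc, simp add: r_def)
  have rnm: "(\<integral>\<^sup>+x. ennreal ((f (r n) x - f (r m) x)\<^sup>2) \<partial>M) \<le> ennreal ((1/4) ^ n)" if "n \<le> m" for n m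
    using N[of n "r n" "r m"] rN[of n] monoD[OF strict_mono_mono[OF r] that] by simp
  define d where "d = (\<lambda>k x. f (r (Suc k)) x - f (r k) x)"
  have [measurable]: "d k \<in> borel_measurable M" for k by (simp add: d_def)
  have "(\<integral>\<^sup>+x. (\<Sum>k. ennreal (2 ^ k) * ennreal ((d k x)\<^sup>2)) \<partial>M)
      = (\<Sum>k. ennreal (2 ^ k) * (\<integral>\<^sup>+x. ennreal ((d k x)\<^sup>2) \<partial>M))"
    by (simp add: nn_integral_suminf nn_integral_cmult)
  also have "\<dots> \<le> (\<Sum>k. ennreal ((1/2) ^ k))"
  proof (intro suminf_le allI)
    fix k
    have "(\<integral>\<^sup>+x. ennreal ((d k x)\<^sup>2) \<partial>M) \<le> ennreal ((1/4) ^ k)"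
      using rnm[of k "Suc k"] by (simp add: d_def power2_commute)
    then have "ennreal (2 ^ k) * (\<integral>\<^sup>+x. ennreal ((d k x)\<^sup>2) \<partial>M) \<le> ennreal (2 ^ k) * ennreal ((1/4) ^ k)"
      by (rule mult_left_mono) simp
    also have "\<dots> = ennreal ((1/2) ^ k)"
      by (simp add: ennreal_mult'[symmetric] power_mult_distrib[symmetric])
    finally show "ennreal (2 ^ k) * (\<integral>\<^sup>+x. ennreal ((d k x)\<^sup>2) \<partial>M) \<le> ennreal ((1/2) ^ k)" .
  qed auto
  also have "\<dots> < \<infinity>"
    by (subst suminf_ennreal2) (auto intro: summable_geometric)
  finally have "AE x in M. (\<Sum>k. ennreal (2 ^ k) * ennreal ((d k x)\<^sup>2)) \<noteq> \<infinity>"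
    by (intro nn_integral_PInf_AE) auto
  then have "AE x in M. convergent (\<lambda>n. f (r n) x)"
  proof eventually_elim
    case (elim x)
    then obtain c where c: "(\<Sum>k. ennreal (2 ^ k) * ennreal ((d k x)\<^sup>2)) = ennreal c" "c \<ge> 0"
      by (cases "\<Sum>k. ennreal (2 ^ k) * ennreal ((d k x)\<^sup>2)") auto
    have bound: "\<bar>d k x\<bar> \<le> sqrt c * sqrt (1/2) ^ k" for k
    proof -
      have "ennreal (2 ^ k * (d k x)\<^sup>2) \<le> ennreal c"
        using ennreal_term_le_suminf[of "\<lambda>k. ennreal (2 ^ k) * ennreal ((d k x)\<^sup>2)" k] c
        by (simp add: ennreal_mult')
      then have "2 ^ k * (d k x)\<^sup>2 \<le> c" using c by (simp add: ennreal_le_iff)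
      then have "(d k x)\<^sup>2 \<le> c * (1/2) ^ k" by (simp add: field_simps power_one_over)
      then have "sqrt ((d k x)\<^sup>2) \<le> sqrt (c * (1/2) ^ k)" by (rule real_sqrt_le_mono)
      then have "\<bar>d k x\<bar> \<le> sqrt (c * (1/2) ^ k)" unfolding real_sqrt_abs .
      then show ?thesis by (simp only: real_sqrt_mult real_sqrt_power)
    qed
    have "summable (\<lambda>k. d k x)"
    proof (rule summable_comparison_test')
      show "summable (\<lambda>k. sqrt c * sqrt (1/2) ^ k)"
        by (intro summable_mult summable_geometric) (simp add: real_sqrt_divide)
      show "norm (d k x) \<le> sqrt c * sqrt (1/2) ^ k" for k using bound by simp
    qed
    then have "(\<lambda>n. \<Sum>k<n. d k x) \<longlonglongrightarrow> (\<Sum>k. d k x)" by (rule summable_LIMSEQ)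
    moreover have "(\<Sum>k<n. d k x) = f (r n) x - f (r 0) x" for n
      unfolding d_def by (rule sum_lessThan_telescope)
    ultimately have "(\<lambda>n. f (r n) x - f (r 0) x + f (r 0) x) \<longlonglongrightarrow> (\<Sum>k. d k x) + f (r 0) x"
      by (intro tendsto_add) auto
    then show ?case by (auto simp: convergent_def)
  qed
  then have lim: "AE x in M. (\<lambda>n. f (r n) x) \<longlonglongrightarrow> lim (\<lambda>n. f (r n) x)"
    by eventually_elim (simp add: convergent_LIMSEQ_iff)
  define g where "g = (\<lambda>x. lim (\<lambda>n. f (r n) x))"
  have [measurable]: "g \<in> borel_measurable M"
    unfolding g_def by (rule borel_measurable_lim_metric) simp
  have "(\<integral>\<^sup>+x. ennreal ((f (r n) x - g x)\<^sup>2) \<partial>M) \<le> ennreal ((1/4) ^ n)" for n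
  proof (rule nn_integral_le_if_AE_limit)
    show "AE x in M. (\<lambda>m. ennreal ((f (r n) x - f (r m) x)\<^sup>2)) \<longlonglongrightarrow> ennreal ((f (r n) x - g x)\<^sup>2)"
      using lim by eventually_elim (auto simp: g_def intro!: tendsto_intros)
    show "eventually (\<lambda>m. (\<integral>\<^sup>+x. ennreal ((f (r n) x - f (r m) x)\<^sup>2) \<partial>M) \<le> ennreal ((1/4) ^ n)) sequentially"
      using eventually_ge_at_top[of n] by eventually_elim (rule rnm)
  qed simp
  moreover have "(\<lambda>n. ennreal ((1/4) ^ n)) \<longlonglongrightarrow> 0"
    using tendsto_ennrealI[OF LIMSEQ_realpow_zero[of "1/4"]] by simp
  ultimately have "(\<lambda>n. \<integral>\<^sup>+x. ennreal ((f (r n) x - g x)\<^sup>2) \<partial>M) \<longlonglongrightarrow> 0"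
    by (rule ennreal_tendsto_0_if_le)
  moreover have "AE x in M. (\<lambda>n. f (r n) x) \<longlonglongrightarrow> g x"
    unfolding g_def by (rule lim)
  ultimately show thesis using r by (intro that[of r g]) simp_all
qed

section \<open>Compactness in the space of square integrable functions\<close>

lemma square_diff_le: "(a - b)\<^sup>2 \<le> 2 * a\<^sup>2 + 2 * b\<^sup>2" for a b :: real
  using zero_le_power2[of "a + b"] by (simp add: power2_eq_square algebra_simps)

lemma mass_diff_le:
  assumes [measurable]: "u \<in> borel_measurable borel" "v \<in> borel_measurable borel"
  shows "mass (\<lambda>x. u x - v x) \<le> 2 * mass u + 2 * mass v"
proof -
  have "mass (\<lambda>x. u x - v x) \<le> (\<integral>\<^sup>+x. 2 * ennreal ((u x)\<^sup>2) + 2 * ennreal ((v x)\<^sup>2) \<partial>lborel)"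
    unfolding mass_def using square_diff_le
    by (intro nn_integral_mono) (simp flip: ennreal_numeral ennreal_mult' ennreal_plus add: ennreal_leI)
  also have "\<dots> = 2 * mass u + 2 * mass v"
    by (simp add: mass_def nn_integral_add nn_integral_cmult)
  finally show ?thesis .
qed

lemma moment_diff_le:
  assumes [measurable]: "u \<in> borel_measurable borel" "v \<in> borel_measurable borel"
  shows "moment (\<lambda>x. u x - v x) \<le> 2 * moment u + 2 * moment v"
proof -
  have "(norm x)\<^sup>2 * (u x - v x)\<^sup>2 \<le> 2 * ((norm x)\<^sup>2 * (u x)\<^sup>2) + 2 * ((norm x)\<^sup>2 * (v x)\<^sup>2)" for x
    using mult_left_mono[OF square_diff_le[of "u x" "v x"], of "(norm x)\<^sup>2"] by (simp add: algebra_simps)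
  then have "moment (\<lambda>x. u x - v x)
      \<le> (\<integral>\<^sup>+x. 2 * ennreal ((norm x)\<^sup>2 * (u x)\<^sup>2) + 2 * ennreal ((norm x)\<^sup>2 * (v x)\<^sup>2) \<partial>lborel)"
    unfolding moment_def
    by (intro nn_integral_mono) (simp flip: ennreal_numeral ennreal_mult' ennreal_plus add: ennreal_leI)
  also have "\<dots> = 2 * moment u + 2 * moment v"
    by (simp add: moment_def nn_integral_add nn_integral_cmult)
  finally show ?thesis .
qed

lemma gagliardo_diff_le:
  fixes u v :: "real ^ 'n \<Rightarrow> real"
  assumes [measurable]: "u \<in> borel_measurable borel" "v \<in> borel_measurable borel"
  shows "gagliardo s (\<lambda>x. u x - v x) \<le> 2 * gagliardo s u + 2 * gagliardo s v"
proof -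
  have pt: "ennreal (\<bar>(u x - v x) - (u y - v y)\<bar>\<^sup>2 / k)
      \<le> 2 * ennreal (\<bar>u x - u y\<bar>\<^sup>2 / k) + 2 * ennreal (\<bar>v x - v y\<bar>\<^sup>2 / k)" if "0 \<le> k" for x y k
  proof -
    have "(u x - v x) - (u y - v y) = (u x - u y) - (v x - v y)" by simp
    then have "\<bar>(u x - v x) - (u y - v y)\<bar>\<^sup>2 \<le> 2 * \<bar>u x - u y\<bar>\<^sup>2 + 2 * \<bar>v x - v y\<bar>\<^sup>2"
      using square_diff_le[of "u x - u y" "v x - v y"] by (simp only: power2_abs)
    from divide_right_mono[OF this that]
    have "\<bar>(u x - v x) - (u y - v y)\<bar>\<^sup>2 / k \<le> 2 * (\<bar>u x - u y\<bar>\<^sup>2 / k) + 2 * (\<bar>v x - v y\<bar>\<^sup>2 / k)"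
      by (simp add: add_divide_distrib)
    then show ?thesis
      using that by (simp flip: ennreal_numeral ennreal_mult' ennreal_plus add: ennreal_leI del: times_divide_eq_right)
  qed
  have "frac_density s (\<lambda>x. u x - v x) x \<le> 2 * frac_density s u x + 2 * frac_density s v x" for x
  proof -
    have "frac_density s (\<lambda>x. u x - v x) x
        \<le> (\<integral>\<^sup>+y. 2 * ennreal (\<bar>u x - u y\<bar>\<^sup>2 / norm (x - y) powr (real CARD('n) + 2 * s))
             + 2 * ennreal (\<bar>v x - v y\<bar>\<^sup>2 / norm (x - y) powr (real CARD('n) + 2 * s)) \<partial>lborel)"
      unfolding frac_density_def by (intro nn_integral_mono pt) simp
    also have "\<dots> = 2 * frac_density s u x + 2 * frac_density s v x"
      unfolding frac_density_def by (simp add: nn_integral_add nn_integral_cmult)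
    finally show ?thesis .
  qed
  then have "gagliardo s (\<lambda>x. u x - v x) \<le> (\<integral>\<^sup>+x. 2 * frac_density s u x + 2 * frac_density s v x \<partial>lborel)"
    unfolding gagliardo_eq_integral_density by (intro nn_integral_mono)
  also have "\<dots> = 2 * gagliardo s u + 2 * gagliardo s v"
    unfolding gagliardo_eq_integral_density by (simp add: nn_integral_add nn_integral_cmult)
  finally show ?thesis .
qed

definition cell_index :: "nat \<Rightarrow> real ^ 'n \<Rightarrow> 'n \<Rightarrow> int" where
  "cell_index k x i = \<lfloor>real (Suc k) * x $ i\<rfloor>"

text \<open>
  The cells of a fixed \<open>k\<close> are the half-open cubes of side \<open>1 / (k + 1)\<close> of a grid. Their index type is
  countable, as the diagonal argument below requires.
\<close>

definition cell :: "nat \<Rightarrow> ('n \<Rightarrow> int) \<Rightarrow> (real ^ 'n) set" where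
  "cell k z = {x. cell_index k x = z}"

lemma cell_eq: "cell k z = (\<Inter>i. {x. of_int (z i) \<le> real (Suc k) * x $ i \<and> real (Suc k) * x $ i < of_int (z i) + 1})"
  by (auto simp: cell_def cell_index_def fun_eq_iff floor_eq_iff simp del: of_nat_Suc)

lemma cell_borel [measurable]: "cell k z \<in> sets borel" for z :: "'n::finite \<Rightarrow> int"
  unfolding cell_eq
proof (intro sets.finite_INT)
  fix i
  have [measurable]: "(\<lambda>x::real ^ 'n. x $ i) \<in> borel_measurable borel"
    by (intro borel_measurable_continuous_onI continuous_intros)
  show "{x::real ^ 'n. of_int (z i) \<le> real (Suc k) * x $ i \<and> real (Suc k) * x $ i < of_int (z i) + 1} \<in> sets borel"
    by measurable
qed auto

lemma cell_index_measurable [measurable]: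
  fixes f :: "('n::finite \<Rightarrow> int) \<Rightarrow> real"
  shows "(\<lambda>x::real ^ 'n. f (cell_index k x)) \<in> borel_measurable borel"
proof (rule measurable_compose[where f = "cell_index k" and g = f and N = "count_space UNIV"])
  show "(cell_index k :: real ^ 'n \<Rightarrow> 'n \<Rightarrow> int) \<in> measurable borel (count_space UNIV)"
    using cell_borel[of k] by (subst measurable_count_space_eq_countable) (auto simp: cell_def vimage_def)
qed simp

lemma cell_volume:
  shows "emeasure lborel (cell k z :: (real ^ 'n) set) = ennreal ((1 / real (Suc k)) ^ CARD('n))"
    and "measure lborel (cell k z :: (real ^ 'n) set) = (1 / real (Suc k)) ^ CARD('n)"
proof -
  define l where "l = (\<chi> i. of_int (z i) / real (Suc k))"
  define w where "w = (\<chi> i. (of_int (z i) + 1) / real (Suc k))"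
  have diff: "(w - l) \<bullet> b = 1 / real (Suc k)" if "b \<in> Basis" for b
    using that by (auto simp: Basis_vec_def inner_axis l_def w_def diff_divide_distrib[symmetric] simp del: of_nat_Suc)
  then have le: "l \<bullet> b \<le> w \<bullet> b" if "b \<in> Basis" for b
    using that[THEN diff] by (simp add: inner_diff_left) (smt (verit) divide_nonneg_nonneg of_nat_0_le_iff)
  have prod: "(\<Prod>b\<in>Basis. (w - l) \<bullet> b) = (1 / real (Suc k)) ^ CARD('n)"
    using diff by simp
  have "box l w \<subseteq> cell k z" "cell k z \<subseteq> cbox l w"
    by (auto simp: cell_eq mem_box_cart l_def w_def field_simps less_imp_le simp del: of_nat_Suc)
  then have "emeasure lborel (box l w) \<le> emeasure lborel (cell k z)"
    "emeasure lborel (cell k z) \<le> emeasure lborel (cbox l w)"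
    by (auto intro!: emeasure_mono)
  then show *: "emeasure lborel (cell k z :: (real ^ 'n) set) = ennreal ((1 / real (Suc k)) ^ CARD('n))"
    using le prod by (auto simp del: of_nat_Suc)
  show "measure lborel (cell k z :: (real ^ 'n) set) = (1 / real (Suc k)) ^ CARD('n)"
    by (simp add: measure_def *)
qed

lemma norm_diff_le_in_cell:
  fixes x y :: "real ^ 'n"
  assumes "y \<in> cell k (cell_index k x)"
  shows "norm (x - y) \<le> real CARD('n) / real (Suc k)"
proof -
  have "\<bar>(x - y) $ i\<bar> \<le> 1 / real (Suc k)" for i
  proof -
    have "\<lfloor>real (Suc k) * y $ i\<rfloor> = \<lfloor>real (Suc k) * x $ i\<rfloor>"
      using assms by (auto simp: cell_def cell_index_def fun_eq_iff)
    then have "\<bar>real (Suc k) * x $ i - real (Suc k) * y $ i\<bar> \<le> 1"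
      by linarith
    then have "real (Suc k) * \<bar>x $ i - y $ i\<bar> \<le> 1"
      by (simp only: right_diff_distrib[symmetric] abs_mult abs_of_nat)
    then show ?thesis by (simp add: field_simps del: of_nat_Suc)
  qed
  then have "(\<Sum>i\<in>UNIV. \<bar>(x - y) $ i\<bar>) \<le> real CARD('n) * (1 / real (Suc k))"
    by (intro sum_bounded_above) auto
  then show ?thesis using norm_le_l1_cart[of "x - y"] by simp
qed

definition cell_average :: "nat \<Rightarrow> (real ^ 'n \<Rightarrow> real) \<Rightarrow> ('n \<Rightarrow> int) \<Rightarrow> real" where
  "cell_average k u z = (LINT y:cell k z|lborel. u y) / measure lborel (cell k z)"

text \<open>
  The factor \<open>d powr (N + 2 * s) / \<bar>Q\<bar>\<close> of the deviation estimate for a cube \<open>Q\<close> of side \<open>1 / (k + 1)\<close>, where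
  the bound \<open>d = N / (k + 1)\<close> for the diameter is used.
\<close>

definition cell_error :: "'n::finite itself \<Rightarrow> real \<Rightarrow> nat \<Rightarrow> real" where
  "cell_error _ s k = real CARD('n) powr (real CARD('n) + 2 * s) * (1 / real (Suc k)) powr (2 * s)"

lemma cell_error_tendsto_0: "0 < s \<Longrightarrow> cell_error T s \<longlonglongrightarrow> 0"
  unfolding cell_error_def[abs_def]
  by (intro tendsto_mult_right_zero tendsto_zero_powrI[where b = "2 * s"] lim_1_over_n[THEN LIMSEQ_Suc])
     (auto intro!: always_eventually)

lemma cell_average_deviation:
  fixes u :: "real ^ 'n \<Rightarrow> real"
  assumes [measurable]: "u \<in> borel_measurable borel" and "mass u < \<infinity>" and s: "0 < s"
  shows "ennreal ((u x - cell_average k u (cell_index k x))\<^sup>2)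
     \<le> ennreal (cell_error TYPE('n) s k) * frac_density s u x"
proof -
  define h where "h = 1 / real (Suc k)"
  have h: "h > 0" by (simp add: h_def)
  have vol: "measure lborel (cell k (cell_index k x)) = h ^ CARD('n)"
    "emeasure lborel (cell k (cell_index k x)) < \<infinity>"
    by (simp_all add: cell_volume h_def)
  have "ennreal ((u x - cell_average k u (cell_index k x))\<^sup>2)
     \<le> ennreal ((real CARD('n) * h) powr (real CARD('n) + 2 * s) / measure lborel (cell k (cell_index k x))) * frac_density s u x"
    unfolding cell_average_def using vol h s assms norm_diff_le_in_cell[of _ k x]
    by (intro deviation_from_average_le set_integrable_if_mass_finite) (auto simp: h_def)
  also have "measure lborel (cell k (cell_index k x)) = h ^ CARD('n)" by (rule vol)
  also have "(real CARD('n) * h) powr (real CARD('n) + 2 * s) / h ^ CARD('n) = cell_error TYPE('n) s k"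
    using h unfolding cell_error_def h_def[symmetric] by (simp add: powr_mult powr_add powr_realpow)
  finally show ?thesis .
qed

lemma cell_average_bound:
  fixes u :: "real ^ 'n \<Rightarrow> real"
  assumes [measurable]: "u \<in> borel_measurable borel" and B: "mass u \<le> ennreal B" "0 \<le> B"
  shows "\<bar>cell_average k u z\<bar> \<le> sqrt (B * real (Suc k) ^ CARD('n))"
proof -
  have vol: "measure lborel (cell k z) = (1 / real (Suc k)) ^ CARD('n)"
    "emeasure lborel (cell k z) < \<infinity>" "measure lborel (cell k z) > 0"
    by (simp_all add: cell_volume)
  have "ennreal ((cell_average k u z)\<^sup>2) \<le> ennreal (1 / measure lborel (cell k z)) * mass u"
    unfolding cell_average_def using vol by (intro square_average_le_mass) auto
  also have "\<dots> \<le> ennreal (1 / measure lborel (cell k z)) * ennreal B"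
    using B by (intro mult_left_mono) auto
  also have "\<dots> = ennreal (B * real (Suc k) ^ CARD('n))"
    unfolding vol using B by (simp add: power_one_over ennreal_mult'[symmetric] mult.commute del: of_nat_Suc)
  finally have "(cell_average k u z)\<^sup>2 \<le> B * real (Suc k) ^ CARD('n)"
    using B by (simp add: ennreal_le_iff del: of_nat_Suc)
  then show ?thesis using real_sqrt_le_mono by fastforce
qed

lemma cell_average_diff:
  fixes u v :: "real ^ 'n \<Rightarrow> real"
  assumes [measurable]: "u \<in> borel_measurable borel" "v \<in> borel_measurable borel"
    and "mass u < \<infinity>" "mass v < \<infinity>"
  shows "cell_average k (\<lambda>x. u x - v x) z = cell_average k u z - cell_average k v z"
proof -
  have "emeasure lborel (cell k z) < \<infinity>" by (simp add: cell_volume)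
  then have "set_integrable lborel (cell k z) u" "set_integrable lborel (cell k z) v"
    using assms by (auto intro: set_integrable_if_mass_finite)
  then show ?thesis by (simp add: cell_average_def set_integral_diff diff_divide_distrib)
qed

text \<open>
  Inside the ball of radius \<open>R\<close>, the difference is replaced by its cell averages, with an error
  controlled by the energy; outside, the second moment bounds it. What is left are the finitely many
  cell averages meeting the ball, which are compared with common values \<open>l\<close>.
\<close>

lemma L2_difference_estimate:
  fixes u v :: "real ^ 'n \<Rightarrow> real"
  assumes [measurable]: "u \<in> borel_measurable borel" "v \<in> borel_measurable borel"
    and B: "0 \<le> B" "mass u \<le> ennreal B" "mass v \<le> ennreal B"
      "gagliardo s u \<le> ennreal B" "gagliardo s v \<le> ennreal B"
      "moment u \<le> ennreal B" "moment v \<le> ennreal B"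
    and s: "0 < s" and R: "0 < R"
  shows "mass (\<lambda>x. u x - v x) \<le> ennreal (8 * B * cell_error TYPE('n) s k) + ennreal (4 * B / R\<^sup>2)
      + (4 * (\<integral>\<^sup>+x. ennreal (indicator (ball 0 R) x * (cell_average k u (cell_index k x) - l (cell_index k x))\<^sup>2) \<partial>lborel)
       + 4 * (\<integral>\<^sup>+x. ennreal (indicator (ball 0 R) x * (cell_average k v (cell_index k x) - l (cell_index k x))\<^sup>2) \<partial>lborel))"
proof -
  define w where "w = (\<lambda>x. u x - v x)"
  define \<delta> where "\<delta> = cell_error TYPE('n) s k"
  have \<delta>: "\<delta> \<ge> 0" by (simp add: \<delta>_def cell_error_def)
  define D where "D = (\<lambda>f x. indicator (ball 0 R) x * (cell_average k f (cell_index k x) - l (cell_index k x))\<^sup>2)"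
  have [measurable]: "w \<in> borel_measurable borel" "D f \<in> borel_measurable borel" for f
    unfolding w_def D_def by measurable
  have fin: "mass u < \<infinity>" "mass v < \<infinity>" using B by (auto intro: le_less_trans)
  have four: "2 * a + 2 * b \<le> ennreal (4 * B)" if "a \<le> ennreal B" "b \<le> ennreal B" for a b
  proof -
    have "2 * a + 2 * b \<le> 2 * ennreal B + 2 * ennreal B"
      using that by (intro add_mono mult_left_mono) auto
    also have "\<dots> = ennreal (4 * B)"
      using B(1) by (simp flip: ennreal_numeral ennreal_mult' ennreal_plus)
    finally show ?thesis .
  qed
  have gw: "gagliardo s w \<le> ennreal (4 * B)" and mw: "moment w \<le> ennreal (4 * B)"
    and aw: "mass w \<le> ennreal (4 * B)"
    unfolding w_def using B four by (auto intro: order_trans[OF gagliardo_diff_le] order_trans[OF moment_diff_le] order_trans[OF mass_diff_le])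
  have "ennreal ((w x)\<^sup>2) \<le> ennreal (2 * \<delta>) * frac_density s w x + ennreal (1 / R\<^sup>2) * ennreal ((norm x)\<^sup>2 * (w x)\<^sup>2)
      + (4 * ennreal (D u x) + 4 * ennreal (D v x))" for x
  proof (cases "norm x < R")
    case True
    define a where "a = cell_average k w (cell_index k x)"
    have "a = (cell_average k u (cell_index k x) - l (cell_index k x)) - (cell_average k v (cell_index k x) - l (cell_index k x))"
      using fin by (simp add: a_def w_def cell_average_diff)
    then have "a\<^sup>2 \<le> 2 * D u x + 2 * D v x"
      using square_diff_le[of "cell_average k u (cell_index k x) - l (cell_index k x)"
          "cell_average k v (cell_index k x) - l (cell_index k x)"] True by (simp add: D_def)
    moreover have "(w x)\<^sup>2 \<le> 2 * (w x - a)\<^sup>2 + 2 * a\<^sup>2"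
      using square_diff_le[of "w x - a" "- a"] by simp
    ultimately have "(w x)\<^sup>2 \<le> 2 * (w x - a)\<^sup>2 + (4 * D u x + 4 * D v x)" by linarith
    then have "ennreal ((w x)\<^sup>2) \<le> 2 * ennreal ((w x - a)\<^sup>2) + (4 * ennreal (D u x) + 4 * ennreal (D v x))"
      by (simp add: D_def ennreal_leI flip: ennreal_numeral ennreal_mult' ennreal_plus)
    also have "2 * ennreal ((w x - a)\<^sup>2) \<le> 2 * (ennreal \<delta> * frac_density s w x)"
      unfolding a_def \<delta>_def using aw s
      by (intro mult_left_mono cell_average_deviation) (auto intro: le_less_trans)
    also have "\<dots> = ennreal (2 * \<delta>) * frac_density s w x"
      using \<delta> by (simp add: ennreal_mult' mult.assoc)
    also have "\<dots> \<le> ennreal (2 * \<delta>) * frac_density s w x + ennreal (1 / R\<^sup>2) * ennreal ((norm x)\<^sup>2 * (w x)\<^sup>2)"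
      by simp
    finally show ?thesis by (simp add: add_mono)
  next
    case False
    then have "R\<^sup>2 \<le> (norm x)\<^sup>2" using R by (intro power_mono) auto
    then have "(w x)\<^sup>2 \<le> 1 / R\<^sup>2 * ((norm x)\<^sup>2 * (w x)\<^sup>2)"
      using R by (simp add: pos_le_divide_eq mult.commute[of "(w x)\<^sup>2"] mult_right_mono)
    then have "ennreal ((w x)\<^sup>2) \<le> ennreal (1 / R\<^sup>2) * ennreal ((norm x)\<^sup>2 * (w x)\<^sup>2)"
      using R by (subst ennreal_mult'[symmetric]) (auto intro: ennreal_leI)
    then show ?thesis by (simp add: add_increasing add_increasing2)
  qed
  then have "mass w \<le> (\<integral>\<^sup>+x. ennreal (2 * \<delta>) * frac_density s w x + ennreal (1 / R\<^sup>2) * ennreal ((norm x)\<^sup>2 * (w x)\<^sup>2)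
      + (4 * ennreal (D u x) + 4 * ennreal (D v x)) \<partial>lborel)"
    unfolding mass_def by (intro nn_integral_mono)
  also have "\<dots> = ennreal (2 * \<delta>) * gagliardo s w + ennreal (1 / R\<^sup>2) * moment w
     + (4 * (\<integral>\<^sup>+x. ennreal (D u x) \<partial>lborel) + 4 * (\<integral>\<^sup>+x. ennreal (D v x) \<partial>lborel))"
    unfolding gagliardo_eq_integral_density moment_def
    by (simp add: nn_integral_add nn_integral_cmult)
  also have "\<dots> \<le> ennreal (2 * \<delta>) * ennreal (4 * B) + ennreal (1 / R\<^sup>2) * ennreal (4 * B)
     + (4 * (\<integral>\<^sup>+x. ennreal (D u x) \<partial>lborel) + 4 * (\<integral>\<^sup>+x. ennreal (D v x) \<partial>lborel))"
    using gw mw by (intro add_mono mult_left_mono) auto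
  also have "ennreal (2 * \<delta>) * ennreal (4 * B) = ennreal (8 * B * \<delta>)"
    using B \<delta> by (simp add: ennreal_mult'[symmetric] mult_ac)
  also have "ennreal (1 / R\<^sup>2) * ennreal (4 * B) = ennreal (4 * B / R\<^sup>2)"
    using B by (simp add: ennreal_mult'[symmetric])
  finally show ?thesis by (simp add: w_def D_def \<delta>_def)
qed

text \<open>
  A diagonal argument makes all cell averages on all grids converge. By the previous estimate, the
  subsequence is then Cauchy in \<open>L\<^sup>2\<close>: choose the grid fine, then the ball large, then the indices large.
\<close>

lemma bounded_Sigma_sequence_convergent_subsequence:
  fixes u :: "nat \<Rightarrow> real ^ 'n \<Rightarrow> real"
  assumes u[measurable]: "\<And>n. u n \<in> borel_measurable borel"
    and B: "0 \<le> B" "\<And>n. mass (u n) \<le> ennreal B" "\<And>n. gagliardo s (u n) \<le> ennreal B" "\<And>n. moment (u n) \<le> ennreal B"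
    and s: "0 < s"
  obtains r v where "strict_mono (r :: nat \<Rightarrow> nat)" "v \<in> borel_measurable borel"
    "AE x in lborel. (\<lambda>n. u (r n) x) \<longlonglongrightarrow> v x" "(\<lambda>n. mass (\<lambda>x. u (r n) x - v x)) \<longlonglongrightarrow> 0"
proof -
  define bnd where "bnd = (\<lambda>k. sqrt (B * real (Suc k) ^ CARD('n)))"
  have bnd: "\<bar>cell_average k (u n) z\<bar> \<le> bnd k" for k n z
    unfolding bnd_def using B by (intro cell_average_bound) auto
  have bnd_pos: "bnd k > 0 \<or> bnd k = 0" for k using B(1) by (auto simp: bnd_def)
  \<comment> \<open>The averages on the \<open>k\<close>-th grid are bounded by \<open>bnd k\<close>, which grows with \<open>k\<close>;
    the normalization gives the uniform bound \<open>1\<close> over all grids.\<close>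
  define F where "F = (\<lambda>n (p :: nat \<times> ('n \<Rightarrow> int)). cell_average (fst p) (u n) (snd p) / (1 + bnd (fst p)))"
  have "norm (F n p) \<le> 1" for n p
    using bnd[of "fst p" n "snd p"] bnd_pos[of "fst p"] by (auto simp: F_def divide_le_eq_1)
  then obtain q where q: "strict_mono (q :: nat \<Rightarrow> nat)" "\<And>p. \<exists>l. (\<lambda>n. F (q n) p) \<longlonglongrightarrow> l"
    using function_convergent_subsequence[of UNIV F 1] by (metis UNIV_I countableI_type)
  have "\<exists>l. \<forall>k z. (\<lambda>n. cell_average k (u (q n)) z) \<longlonglongrightarrow> l k z"
  proof -
    have "\<exists>l. (\<lambda>n. cell_average k (u (q n)) z) \<longlonglongrightarrow> l" for k z
    proof -
      obtain l where "(\<lambda>n. F (q n) (k, z)) \<longlonglongrightarrow> l" using q(2) by blast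
      then have "(\<lambda>n. F (q n) (k, z) * (1 + bnd k)) \<longlonglongrightarrow> l * (1 + bnd k)"
        by (intro tendsto_intros)
      then show ?thesis using bnd_pos[of k] by (auto simp: F_def add_pos_pos)
    qed
    then show ?thesis by metis
  qed
  then obtain l where l: "\<And>k z. (\<lambda>n. cell_average k (u (q n)) z) \<longlonglongrightarrow> l k z" by blast
  have l_bnd: "\<bar>l k z\<bar> \<le> bnd k" for k z
    using LIMSEQ_le_const2[OF tendsto_rabs[OF l[of k z]], of "bnd k"] bnd by auto
  define D where "D = (\<lambda>k R n. \<integral>\<^sup>+x. ennreal (indicator (ball 0 R) x * (cell_average k (u (q n)) (cell_index k x) - l k (cell_index k x))\<^sup>2) \<partial>lborel)"
  have D: "D k R \<longlonglongrightarrow> 0" for k R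
  proof -
    have "D k R \<longlonglongrightarrow> (\<integral>\<^sup>+x. 0 \<partial>(lborel :: (real ^ 'n) measure))"
      unfolding D_def
    proof (rule nn_integral_dominated_convergence[where w = "\<lambda>x. ennreal ((2 * bnd k)\<^sup>2) * indicator (ball 0 R) x"])
      show "AE x in lborel. ennreal (indicator (ball 0 R) x * (cell_average k (u (q n)) (cell_index k x) - l k (cell_index k x))\<^sup>2)
          \<le> ennreal ((2 * bnd k)\<^sup>2) * indicator (ball 0 R) x" for n
      proof (intro AE_I2)
        fix x
        have "\<bar>cell_average k (u (q n)) (cell_index k x) - l k (cell_index k x)\<bar> \<le> 2 * bnd k"
          using bnd[of k "q n" "cell_index k x"] l_bnd[of k "cell_index k x"] by linarith
        then have "(cell_average k (u (q n)) (cell_index k x) - l k (cell_index k x))\<^sup>2 \<le> (2 * bnd k)\<^sup>2"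
          using abs_le_square_iff by fastforce
        then show "ennreal (indicator (ball 0 R) x * (cell_average k (u (q n)) (cell_index k x) - l k (cell_index k x))\<^sup>2)
          \<le> ennreal ((2 * bnd k)\<^sup>2) * indicator (ball 0 R) x"
          by (auto simp: indicator_def ennreal_leI)
      qed
      show "(\<integral>\<^sup>+x. ennreal ((2 * bnd k)\<^sup>2) * indicator (ball 0 R) (x::real ^ 'n) \<partial>lborel) < \<infinity>"
        using emeasure_lborel_ball_finite[of "0::real ^ 'n" R]
        by (subst nn_integral_cmult_indicator) (auto simp: ennreal_mult_less_top)
      show "AE x in lborel. (\<lambda>n. ennreal (indicator (ball 0 R) x * (cell_average k (u (q n)) (cell_index k x) - l k (cell_index k x))\<^sup>2)) \<longlonglongrightarrow> 0"
      proof (intro AE_I2)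
        fix x :: "real ^ 'n"
        have "(\<lambda>n. indicator (ball 0 R) x * (cell_average k (u (q n)) (cell_index k x) - l k (cell_index k x))\<^sup>2)
            \<longlonglongrightarrow> indicator (ball 0 R) x * (l k (cell_index k x) - l k (cell_index k x))\<^sup>2"
          by (intro tendsto_intros l)
        then show "(\<lambda>n. ennreal (indicator (ball 0 R) x * (cell_average k (u (q n)) (cell_index k x) - l k (cell_index k x))\<^sup>2)) \<longlonglongrightarrow> 0"
          using tendsto_ennrealI by fastforce
      qed
    qed simp_all
    then show ?thesis by simp
  qed
  have "\<exists>n0. \<forall>n\<ge>n0. \<forall>m\<ge>n0. (\<integral>\<^sup>+x. ennreal ((u (q n) x - u (q m) x)\<^sup>2) \<partial>lborel) \<le> ennreal e" if e: "0 < e" for e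
  proof -
    have "(\<lambda>k. 8 * B * cell_error TYPE('n) s k) \<longlonglongrightarrow> 0"
      by (intro tendsto_mult_right_zero cell_error_tendsto_0 s)
    then have "eventually (\<lambda>k. 8 * B * cell_error TYPE('n) s k < e / 3) sequentially"
      using e by (intro order_tendstoD(2)) auto
    then obtain k where k: "8 * B * cell_error TYPE('n) s k < e / 3"
      by (auto simp: eventually_sequentially)
    \<comment> \<open>The summand \<open>1\<close> keeps \<open>R\<close> positive when \<open>B = 0\<close>.\<close>
    define R where "R = sqrt (12 * B / e + 1)"
    have R2: "R\<^sup>2 = 12 * B / e + 1" using B e by (simp add: R_def)
    have R: "R > 0" using B e by (simp add: R_def add_nonneg_pos)
    have Re: "4 * B / R\<^sup>2 \<le> e / 3"
      unfolding R2 using B e by (simp add: field_simps)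
    have "eventually (\<lambda>n. D k R n < ennreal (e / 24)) sequentially"
      using D[of k R] e by (intro order_tendstoD(2)) auto
    then obtain n0 where n0: "\<And>n. n \<ge> n0 \<Longrightarrow> D k R n < ennreal (e / 24)"
      by (auto simp: eventually_sequentially)
    have "mass (\<lambda>x. u (q n) x - u (q m) x) \<le> ennreal e" if nm: "n \<ge> n0" "m \<ge> n0" for n m
    proof -
      have "mass (\<lambda>x. u (q n) x - u (q m) x)
          \<le> ennreal (8 * B * cell_error TYPE('n) s k) + ennreal (4 * B / R\<^sup>2) + (4 * D k R n + 4 * D k R m)"
        unfolding D_def using B s R by (intro L2_difference_estimate) auto
      also have "\<dots> \<le> ennreal (e / 3) + ennreal (e / 3) + (4 * ennreal (e / 24) + 4 * ennreal (e / 24))"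
        using k Re n0[OF nm(1)] n0[OF nm(2)] by (intro add_mono mult_left_mono ennreal_leI) auto
      also have "\<dots> = ennreal e"
        using e by (simp flip: ennreal_numeral ennreal_mult' ennreal_plus)
      finally show ?thesis .
    qed
    then show ?thesis unfolding mass_def by blast
  qed
  then obtain r g where "strict_mono (r :: nat \<Rightarrow> nat)" "g \<in> borel_measurable lborel"
    "AE x in lborel. (\<lambda>n. u (q (r n)) x) \<longlonglongrightarrow> g x"
    "(\<lambda>n. \<integral>\<^sup>+x. ennreal ((u (q (r n)) x - g x)\<^sup>2) \<partial>lborel) \<longlonglongrightarrow> 0"
    by (rule L2_Cauchy_imp_convergent_subsequence[of "\<lambda>n. u (q n)" lborel, rotated]) simp_all
  then show thesis
    using q(1) by (intro that[of "q \<circ> r" g]) (auto simp: mass_def intro: strict_mono_o)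
qed

section \<open>Existence of a minimizer\<close>

lemma nn_integral_le_liminf:
  fixes F :: "nat \<Rightarrow> 'a \<Rightarrow> ennreal"
  assumes [measurable]: "\<And>n. F n \<in> borel_measurable M"
    and "AE x in M. G x \<le> liminf (\<lambda>n. F n x)"
  shows "(\<integral>\<^sup>+x. G x \<partial>M) \<le> liminf (\<lambda>n. \<integral>\<^sup>+x. F n x \<partial>M)"
proof -
  have "(\<integral>\<^sup>+x. G x \<partial>M) \<le> (\<integral>\<^sup>+x. liminf (\<lambda>n. F n x) \<partial>M)"
    using assms(2) by (rule nn_integral_mono_AE)
  also have "\<dots> \<le> liminf (\<lambda>n. \<integral>\<^sup>+x. F n x \<partial>M)"
    by (rule nn_integral_liminf) simp
  finally show ?thesis .
qed

lemma gagliardo_le_liminf: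
  fixes u :: "nat \<Rightarrow> real ^ 'n \<Rightarrow> real"
  assumes [measurable]: "\<And>n. u n \<in> borel_measurable borel"
    and lim: "AE x in lborel. (\<lambda>n. u n x) \<longlonglongrightarrow> v x"
  shows "gagliardo s v \<le> liminf (\<lambda>n. gagliardo s (u n))"
  unfolding gagliardo_eq_integral_density
proof (rule nn_integral_le_liminf)
  show "AE x in lborel. frac_density s v x \<le> liminf (\<lambda>n. frac_density s (u n) x)"
    using lim
  proof eventually_elim
    case (elim x)
    show ?case
      unfolding frac_density_def
    proof (rule nn_integral_le_liminf)
      show "AE y in lborel. ennreal (\<bar>v x - v y\<bar>\<^sup>2 / norm (x - y) powr (real CARD('n) + 2 * s))
         \<le> liminf (\<lambda>n. ennreal (\<bar>u n x - u n y\<bar>\<^sup>2 / norm (x - y) powr (real CARD('n) + 2 * s)))"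
        using lim
      proof eventually_elim
        case (elim y)
        have "(\<lambda>n. \<bar>u n x - u n y\<bar>\<^sup>2 * inverse (norm (x - y) powr (real CARD('n) + 2 * s)))
           \<longlonglongrightarrow> \<bar>v x - v y\<bar>\<^sup>2 * inverse (norm (x - y) powr (real CARD('n) + 2 * s))"
          by (intro tendsto_intros elim \<open>(\<lambda>n. u n x) \<longlonglongrightarrow> v x\<close>)
        then have "(\<lambda>n. ennreal (\<bar>u n x - u n y\<bar>\<^sup>2 / norm (x - y) powr (real CARD('n) + 2 * s)))
           \<longlonglongrightarrow> ennreal (\<bar>v x - v y\<bar>\<^sup>2 / norm (x - y) powr (real CARD('n) + 2 * s))"
          unfolding divide_inverse by (rule tendsto_ennrealI)
        from lim_imp_Liminf[OF sequentially_bot this] show ?case by simp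
      qed
    qed simp
  qed
qed simp

text \<open>
  Write \<open>\<bar>a\<bar> \<le> (1 - t) * (\<bar>b\<bar> / (1 - t)) + t * (\<bar>a - b\<bar> / t)\<close> and use convexity. The first coefficient tends
  to \<open>1\<close> as \<open>t\<close> tends to \<open>0\<close>, so a small power integral of \<open>a - b\<close> makes that of \<open>a\<close> at most slightly
  larger than that of \<open>b\<close>.
\<close>

lemma power_convexity_split:
  fixes a b :: real
  assumes p: "1 \<le> p" and t: "0 < t" "t < 1"
  shows "\<bar>a\<bar> powr p \<le> (1 - t) powr (1 - p) * \<bar>b\<bar> powr p + t powr (1 - p) * \<bar>a - b\<bar> powr p"
proof (cases "b = 0 \<or> a = b")
  case True
  have "1 \<le> x powr (1 - p)" if "0 < x" "x < 1" for x :: real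
  proof -
    have "x powr (p - 1) \<le> 1" using that p by (intro powr_le1) auto
    moreover have "x powr (1 - p) = inverse (x powr (p - 1))" by (simp flip: powr_minus)
    ultimately show ?thesis using that by (simp add: one_le_inverse)
  qed
  from this[of t] this[of "1 - t"] t have "1 \<le> t powr (1 - p)" "1 \<le> (1 - t) powr (1 - p)" by auto
  then have "1 * \<bar>a\<bar> powr p \<le> t powr (1 - p) * \<bar>a\<bar> powr p" "1 * \<bar>a\<bar> powr p \<le> (1 - t) powr (1 - p) * \<bar>a\<bar> powr p"
    by (intro mult_right_mono; simp)+
  then show ?thesis using True by auto
next
  case False
  define x where "x = \<bar>b\<bar> / (1 - t)"
  define y where "y = \<bar>a - b\<bar> / t"
  have x: "x > 0" and y: "y > 0" using False t by (auto simp: x_def y_def)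
  have "\<bar>a\<bar> \<le> (1 - t) * x + t * y" using t by (simp add: x_def y_def)
  then have "\<bar>a\<bar> powr p \<le> ((1 - t) * x + t * y) powr p"
    using p by (intro powr_mono2) auto
  also have "\<dots> \<le> (1 - t) * x powr p + t * y powr p"
    using convex_onD[OF powr_convex[OF p], of t x y] t x y by simp
  also have "(1 - t) * x powr p = (1 - t) powr (1 - p) * \<bar>b\<bar> powr p"
    using t by (simp add: x_def powr_divide powr_diff)
  also have "t * y powr p = t powr (1 - p) * \<bar>a - b\<bar> powr p"
    using t by (simp add: y_def powr_divide powr_diff)
  finally show ?thesis .
qed

lemma power_integral_eventually_le:
  fixes u :: "nat \<Rightarrow> 'a::euclidean_space \<Rightarrow> real"
  assumes [measurable]: "\<And>n. u n \<in> borel_measurable borel" "v \<in> borel_measurable borel"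
    and p: "1 \<le> p" and conv: "(\<lambda>n. power_integral p (\<lambda>x. u n x - v x)) \<longlonglongrightarrow> 0"
    and w: "power_integral p v = ennreal w" "0 \<le> w" and e: "0 < e"
  shows "eventually (\<lambda>n. power_integral p (u n) \<le> ennreal (w + e)) sequentially"
proof -
  have "((\<lambda>t. (1 - t) powr (1 - p) * w) \<longlongrightarrow> (1 - 0) powr (1 - p) * w) (at_right 0)"
    by (intro tendsto_intros) auto
  then have "eventually (\<lambda>t. (1 - t) powr (1 - p) * w < w + e / 2) (at_right 0)"
    using e by (intro order_tendstoD(2)) auto
  moreover have "eventually (\<lambda>t. t \<in> {0<..<1::real}) (at_right 0)"
    by (rule eventually_at_right_real) simp
  ultimately have "eventually (\<lambda>t. (1 - t) powr (1 - p) * w < w + e / 2 \<and> 0 < t \<and> t < 1) (at_right 0)"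
    by eventually_elim auto
  then obtain t where t: "(1 - t) powr (1 - p) * w < w + e / 2" "0 < t" "t < 1"
    using eventually_happens'[OF trivial_limit_at_right_real] by blast
  define T where "T = t powr (1 - p)"
  have T: "T > 0" using t by (simp add: T_def)
  have "eventually (\<lambda>n. power_integral p (\<lambda>x. u n x - v x) < ennreal (e / (2 * T))) sequentially"
    using e T by (intro order_tendstoD(2)[OF conv]) auto
  then show ?thesis
  proof eventually_elim
    case (elim n)
    have "power_integral p (u n)
       \<le> (\<integral>\<^sup>+x. ennreal ((1 - t) powr (1 - p)) * ennreal (\<bar>v x\<bar> powr p) + ennreal T * ennreal (\<bar>u n x - v x\<bar> powr p) \<partial>lborel)"
      unfolding power_integral_def T_def using power_convexity_split[OF p t(2,3)]
      by (intro nn_integral_mono) (simp add: ennreal_leI flip: ennreal_mult' ennreal_plus)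
    also have "\<dots> = ennreal ((1 - t) powr (1 - p)) * power_integral p v + ennreal T * power_integral p (\<lambda>x. u n x - v x)"
      unfolding power_integral_def by (simp add: nn_integral_add nn_integral_cmult)
    also have "\<dots> \<le> ennreal ((1 - t) powr (1 - p)) * ennreal w + ennreal T * ennreal (e / (2 * T))"
      using elim w by (intro add_mono mult_left_mono) auto
    also have "\<dots> = ennreal ((1 - t) powr (1 - p) * w + e / 2)"
      using T e w by (simp flip: ennreal_mult' ennreal_plus)
    also have "\<dots> \<le> ennreal (w + e)" using t by (intro ennreal_leI) linarith
    finally show ?case .
  qed
qed

lemma power_integral_2: "power_integral 2 u = mass u"
proof -
  have "\<bar>t\<bar> powr 2 = t\<^sup>2" for t :: real by (cases "t = 0") (auto simp: powr_numeral)
  then show ?thesis by (simp add: power_integral_def mass_def)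
qed

lemma S_constraint_borel_representative:
  fixes u :: "real ^ 'n \<Rightarrow> real"
  assumes "u \<in> S_constraint C s c"
  obtains v :: "real ^ 'n \<Rightarrow> real" where "v \<in> borel_measurable borel" "v \<in> S_constraint C s c"
    "J_functional C s \<sigma> v = J_functional C s \<sigma> u"
proof -
  have "u \<in> borel_measurable (completion lborel)" using assms by (simp add: S_constraint_iff)
  then obtain v where v[measurable]: "v \<in> borel_measurable lborel" and "AE x in lborel. u x = v x"
    using completion_ex_borel_measurable_real by blast
  then have eq: "AE x in lborel. v x = u x" by auto
  have "v \<in> borel_measurable lebesgue" by (intro measurable_completion) simp
  then have "v \<in> S_constraint C s c"
    using assms mass_cong_AE[OF eq] moment_cong_AE[OF eq] gagliardo_cong_AE[OF eq] by (simp add: S_constraint_iff)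
  moreover have "J_functional C s \<sigma> v = J_functional C s \<sigma> u"
    by (simp add: J_functional_eq gagliardo_cong_AE[OF eq] moment_cong_AE[OF eq] power_integral_cong_AE[OF eq])
  ultimately show thesis using v by (intro that[of v]) auto
qed

lemma J_functional_real:
  assumes "0 \<le> C" "0 \<le> \<sigma>"
    and "gagliardo s u = ennreal g" "moment u = ennreal h" "power_integral (2 * \<sigma> + 2) u = ennreal w"
    and "0 \<le> g" "0 \<le> h" "0 \<le> w"
  shows "J_functional C s \<sigma> u = ereal (C / 2 * g + h / 2 - w / (2 * \<sigma> + 2))"
  using assms by (simp add: J_functional_eq ennreal_mult'[symmetric] enn2ereal_ennreal)

text \<open>
  The level \<open>M\<close> in the Gagliardo--Nirenberg inequality is chosen so that the energy gets the
  coefficient \<open>\<epsilon>\<close>; this is possible because the exponent of \<open>M\<close> there is negative.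
\<close>

lemma power_integral_coercive:
  assumes s: "0 < s" and c: "0 < c" and \<sigma>: "0 < \<sigma>" "\<sigma> < 2 * s / real CARD('n)" and \<epsilon>: "0 < \<epsilon>"
  obtains D where "0 \<le> D" "\<And>u :: real ^ 'n \<Rightarrow> real. u \<in> borel_measurable borel \<Longrightarrow> mass u = ennreal (c\<^sup>2) \<Longrightarrow>
    power_integral (2 * \<sigma> + 2) u \<le> ennreal D + ennreal \<epsilon> * gagliardo s u"
proof -
  define p where "p = 2 * \<sigma> + 2"
  define q where "q = 2 + 4 * s / real CARD('n)"
  have pq: "2 \<le> p" "p < q" using \<sigma> by (auto simp: p_def q_def field_simps)
  obtain K where K: "K > 0" and GN: "\<And>(u :: real ^ 'n \<Rightarrow> real) m M p. u \<in> borel_measurable borel \<Longrightarrow> mass u = ennreal m \<Longrightarrow> 0 \<le> m \<Longrightarrow>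
     0 < M \<Longrightarrow> 2 \<le> p \<Longrightarrow> p \<le> q \<Longrightarrow>
     power_integral p u \<le> ennreal (M powr (p - 2) * m)
       + ennreal (M powr (p - q) * (K * m powr (2 * s / real CARD('n)))) * gagliardo s u"
    using subcritical_gagliardo_nirenberg[OF s, where ?'n = 'n] unfolding q_def by blast
  define A where "A = K * (c\<^sup>2) powr (2 * s / real CARD('n))"
  have A: "A > 0" using K c by (simp add: A_def)
  define M where "M = (\<epsilon> / A) powr (1 / (p - q))"
  have M: "M > 0" using \<epsilon> A by (simp add: M_def)
  have "M powr (p - q) = \<epsilon> / A" using \<epsilon> A pq by (simp add: M_def powr_powr)
  then have MA: "M powr (p - q) * A = \<epsilon>" using A by simp
  show thesis
  proof (rule that[of "M powr (p - 2) * c\<^sup>2"])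
    fix u :: "real ^ 'n \<Rightarrow> real"
    assume "u \<in> borel_measurable borel" "mass u = ennreal (c\<^sup>2)"
    from GN[OF this _ M, of p] show "power_integral (2 * \<sigma> + 2) u \<le> ennreal (M powr (p - 2) * c\<^sup>2) + ennreal \<epsilon> * gagliardo s u"
      using pq MA by (simp add: A_def[symmetric] p_def[symmetric])
  qed simp
qed

lemma power_integral_difference_tendsto_0:
  fixes u :: "nat \<Rightarrow> real ^ 'n \<Rightarrow> real"
  assumes [measurable]: "\<And>n. u n \<in> borel_measurable borel" "v \<in> borel_measurable borel"
    and s: "0 < s" and p: "2 \<le> p" "p \<le> 2 + 4 * s / real CARD('n)"
    and B: "0 \<le> B" "\<And>n. gagliardo s (u n) \<le> ennreal B" "gagliardo s v \<le> ennreal B"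
    and fin: "\<And>n. mass (\<lambda>x. u n x - v x) < \<infinity>"
    and conv: "(\<lambda>n. mass (\<lambda>x. u n x - v x)) \<longlonglongrightarrow> 0"
  shows "(\<lambda>n. power_integral p (\<lambda>x. u n x - v x)) \<longlonglongrightarrow> 0"
proof -
  obtain K where K: "K > 0" and GN: "\<And>(u :: real ^ 'n \<Rightarrow> real) m M p. u \<in> borel_measurable borel \<Longrightarrow> mass u = ennreal m \<Longrightarrow> 0 \<le> m \<Longrightarrow>
     0 < M \<Longrightarrow> 2 \<le> p \<Longrightarrow> p \<le> 2 + 4 * s / real CARD('n) \<Longrightarrow>
     power_integral p u \<le> ennreal (M powr (p - 2) * m)
       + ennreal (M powr (p - (2 + 4 * s / real CARD('n))) * (K * m powr (2 * s / real CARD('n)))) * gagliardo s u"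
    using subcritical_gagliardo_nirenberg[OF s, where ?'n = 'n] by blast
  define m where "m = (\<lambda>n. enn2real (mass (\<lambda>x. u n x - v x)))"
  have m: "mass (\<lambda>x. u n x - v x) = ennreal (m n)" "0 \<le> m n" for n
    using fin[of n] by (simp_all add: m_def)
  have m0: "m \<longlonglongrightarrow> 0"
    using tendsto_enn2real[OF conv[folded ennreal_0]] by (simp add: m_def)
  have bound: "power_integral p (\<lambda>x. u n x - v x) \<le> ennreal (m n + K * m n powr (2 * s / real CARD('n)) * (4 * B))" for n
  proof -
    have "gagliardo s (\<lambda>x. u n x - v x) \<le> 2 * gagliardo s (u n) + 2 * gagliardo s v"
      by (rule gagliardo_diff_le) auto
    also have "\<dots> \<le> 2 * ennreal B + 2 * ennreal B"
      using B by (intro add_mono mult_left_mono) auto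
    also have "\<dots> = ennreal (4 * B)"
      using B(1) by (simp flip: ennreal_numeral ennreal_mult' ennreal_plus)
    finally have G: "gagliardo s (\<lambda>x. u n x - v x) \<le> ennreal (4 * B)" .
    have "power_integral p (\<lambda>x. u n x - v x)
        \<le> ennreal (1 powr (p - 2) * m n) + ennreal (1 powr (p - (2 + 4 * s / real CARD('n))) * (K * m n powr (2 * s / real CARD('n)))) * gagliardo s (\<lambda>x. u n x - v x)"
      using m p by (intro GN) auto
    also have "\<dots> \<le> ennreal (m n) + ennreal (K * m n powr (2 * s / real CARD('n))) * ennreal (4 * B)"
      using G by (intro add_mono mult_mono) auto
    also have "\<dots> = ennreal (m n + K * m n powr (2 * s / real CARD('n)) * (4 * B))"
      using K B m(2)[of n] by (simp flip: ennreal_mult' ennreal_plus)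
    finally show ?thesis .
  qed
  have "(\<lambda>n. ennreal (m n + K * m n powr (2 * s / real CARD('n)) * (4 * B))) \<longlonglongrightarrow> ennreal (0 + K * 0 * (4 * B))"
    using s m0 m by (intro tendsto_ennrealI tendsto_intros tendsto_zero_powrI[where b = "2 * s / real CARD('n)"]) auto
  then have "(\<lambda>n. ennreal (m n + K * m n powr (2 * s / real CARD('n)) * (4 * B))) \<longlonglongrightarrow> 0"
    by simp
  with bound show ?thesis by (rule ennreal_tendsto_0_if_le)
qed

text \<open>
  The energy, the second moment and the power integral of a minimizing sequence are bounded by
  coercivity, so they may be assumed to converge. Passing to the limit function does not increase the
  first two and does not decrease the third.
\<close>

lemma minimizer_exists:
  assumes s: "0 < s" "s < 1" and c: "0 < c" and C: "0 < C"
    and \<sigma>: "0 < \<sigma>" "\<sigma> < 2 * s / real CARD('n::finite)"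
  obtains u :: "real ^ 'n \<Rightarrow> real" where "u \<in> borel_measurable borel" "u \<in> S_constraint C s c"
    "J_functional C s \<sigma> u = I_min TYPE('n) C s \<sigma> c"
proof -
  define p where "p = 2 * \<sigma> + 2"
  have p: "2 \<le> p" "p \<le> 2 + 4 * s / real CARD('n)" "p > 0" using \<sigma> by (auto simp: p_def field_simps)
  let ?S = "S_constraint C s c :: (real ^ 'n \<Rightarrow> real) set"
  let ?J = "J_functional C s \<sigma> :: (real ^ 'n \<Rightarrow> real) \<Rightarrow> ereal"
  define I where "I = I_min TYPE('n) C s \<sigma> c"
  have I: "I = Inf (?J ` ?S)" by (simp add: I_def I_min_def)
  have ne: "?J ` ?S \<noteq> {}" using S_constraint_nonempty[OF s] by blast
  obtain j where j: "\<And>n. j n \<in> ?J ` ?S" "j \<longlonglongrightarrow> I"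
    using Inf_as_limit[OF ne] unfolding I by blast
  have "\<exists>u. u \<in> borel_measurable borel \<and> u \<in> ?S \<and> ?J u = j n" for n
  proof -
    obtain w where "w \<in> ?S" "?J w = j n" using j(1)[of n] by auto
    then show ?thesis using S_constraint_borel_representative[of w C s c \<sigma>] by metis
  qed
  then obtain u where u[measurable]: "\<And>n. u n \<in> borel_measurable borel"
    and uS: "\<And>n. u n \<in> ?S" and uJ: "\<And>n. ?J (u n) = j n"
    by metis
  obtain D where D: "0 \<le> D" and coerc: "\<And>u :: real ^ 'n \<Rightarrow> real. u \<in> borel_measurable borel \<Longrightarrow> mass u = ennreal (c\<^sup>2) \<Longrightarrow>
    power_integral p u \<le> ennreal D + ennreal (p * C / 4) * gagliardo s u"
    \<comment> \<open>With this coefficient the power term costs, up to a constant, at most half of the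
      energy term \<open>C / 2 * gagliardo s u\<close>.\<close>
    using power_integral_coercive[OF s(1) c \<sigma>, of "p * C / 4"] C p unfolding p_def by auto
  define g where "g = (\<lambda>f :: real ^ 'n \<Rightarrow> real. enn2real (gagliardo s f))"
  define h where "h = (\<lambda>f :: real ^ 'n \<Rightarrow> real. enn2real (moment f))"
  define w where "w = (\<lambda>f :: real ^ 'n \<Rightarrow> real. enn2real (power_integral p f))"
  have nonneg: "0 \<le> g f" "0 \<le> h f" "0 \<le> w f" for f by (simp_all add: g_def h_def w_def)
  have reals: "gagliardo s f = ennreal (g f)" "moment f = ennreal (h f)" "power_integral p f = ennreal (w f)"
      "w f \<le> D + p * C / 4 * g f" "?J f = ereal (C / 2 * g f + h f / 2 - w f / p)"
    if f: "f \<in> ?S" "f \<in> borel_measurable borel" for f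
  proof -
    have fin: "gagliardo s f < \<infinity>" "moment f < \<infinity>" "mass f = ennreal (c\<^sup>2)"
      using f by (auto simp: S_constraint_iff)
    show g: "gagliardo s f = ennreal (g f)" and h: "moment f = ennreal (h f)"
      using fin by (simp_all add: g_def h_def)
    have "power_integral p f \<le> ennreal D + ennreal (p * C / 4) * ennreal (g f)"
      using coerc[OF f(2) fin(3)] g by simp
    also have "\<dots> = ennreal (D + p * C / 4 * g f)"
      using D p C nonneg by (simp flip: ennreal_mult' ennreal_plus)
    finally have le: "power_integral p f \<le> ennreal (D + p * C / 4 * g f)" .
    then have "power_integral p f < \<infinity>" by (rule le_less_trans) simp
    then show w: "power_integral p f = ennreal (w f)" by (simp add: w_def)
    have "0 \<le> D + p * C / 4 * g f" using D p C nonneg by simp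
    then show "w f \<le> D + p * C / 4 * g f" using le w by (simp add: ennreal_le_iff)
    show "?J f = ereal (C / 2 * g f + h f / 2 - w f / p)"
      using C \<sigma> g h w nonneg unfolding p_def by (intro J_functional_real) auto
  qed
  note ur = reals[OF uS u]
  have lower: "C / 4 * g f + h f / 2 - D / p \<le> C / 2 * g f + h f / 2 - w f / p"
    if "f \<in> ?S" "f \<in> borel_measurable borel" for f
  proof -
    have "w f / p \<le> (D + p * C / 4 * g f) / p"
      using reals(4)[OF that] p by (intro divide_right_mono) auto
    also have "\<dots> = D / p + C / 4 * g f" using p by (simp add: add_divide_distrib)
    finally show ?thesis by simp
  qed
  have "I \<noteq> \<infinity>"
  proof -
    have "I \<le> ?J (u 0)" unfolding I using uS by (intro Inf_lower) auto
    then show ?thesis using ur(5)[of 0] by auto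
  qed
  moreover have "I \<noteq> -\<infinity>"
  proof -
    have "ereal (- (D / p)) \<le> I"
    proof (rule LIMSEQ_le_const[OF j(2)], intro exI allI impI)
      fix n
      have "- (D / p) \<le> C / 4 * g (u n) + h (u n) / 2 - D / p" using C nonneg by simp
      also note lower[OF uS u, of n]
      finally show "ereal (- (D / p)) \<le> j n" using ur(5)[of n] uJ[of n] by simp
    qed
    then show ?thesis by auto
  qed
  ultimately obtain i where i: "I = ereal i" by (cases I) auto
  define jr where "jr = (\<lambda>n. C / 2 * g (u n) + h (u n) / 2 - w (u n) / p)"
  have jr: "jr \<longlonglongrightarrow> i"
  proof -
    have "j = (\<lambda>n. ereal (jr n))" unfolding jr_def ur(5)[symmetric] uJ ..
    then show ?thesis using j(2) i by simp
  qed
  then have "Bseq jr" by (intro convergent_imp_Bseq) (auto simp: convergent_def)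
  then obtain A where A: "\<And>n. \<bar>jr n\<bar> \<le> A" by (auto simp: Bseq_def)
  define E where "E = A + D / p"
  have E: "C / 4 * g (u n) + h (u n) / 2 \<le> E" for n
    using lower[OF uS u, of n] A[of n] by (simp add: E_def jr_def)
  have hb: "h (u n) \<le> 2 * E" and gb: "g (u n) \<le> 4 * E / C" and wb: "w (u n) \<le> D + p * E" for n
  proof -
    have cg: "0 \<le> C / 4 * g (u n)" using C nonneg by simp
    then show "h (u n) \<le> 2 * E" using E[of n] by linarith
    have cgE: "C / 4 * g (u n) \<le> E" using E[of n] nonneg(2)[of "u n"] by linarith
    then show "g (u n) \<le> 4 * E / C" using C by (simp add: field_simps)
    have "p * (C / 4 * g (u n)) \<le> p * E" using cgE p by (intro mult_left_mono) auto
    then show "w (u n) \<le> D + p * E" using ur(4)[of n] by simp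
  qed
  define B where "B = Max {c\<^sup>2, 2 * E, 4 * E / C, D + p * E}"
  have B: "c\<^sup>2 \<le> B" "2 * E \<le> B" "4 * E / C \<le> B" "D + p * E \<le> B" "0 \<le> B"
    by (auto simp: B_def le_max_iff_disj)
  define T where "T = (\<lambda>n. (g (u n), h (u n), w (u n)))"
  have uB: "g (u n) \<le> B" "h (u n) \<le> B" "w (u n) \<le> B" for n
    using hb[of n] gb[of n] wb[of n] B by linarith+
  then have "range T \<subseteq> {0..B} \<times> {0..B} \<times> {0..B}"
    using nonneg by (auto simp: T_def)
  then have "bounded (range T)"
    by (rule bounded_subset[rotated]) (intro bounded_Times bounded_closed_interval)
  then obtain q l where q: "strict_mono (q :: nat \<Rightarrow> nat)" "(T \<circ> q) \<longlonglongrightarrow> l"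
    using bounded_imp_convergent_subsequence by blast
  obtain lg lh lw where l: "l = (lg, lh, lw)" by (cases l)
  have massu: "mass (u n) = ennreal (c\<^sup>2)" for n using uS[of n] by (simp add: S_constraint_iff)
  have bounds: "mass (u n) \<le> ennreal B" "gagliardo s (u n) \<le> ennreal B" "moment (u n) \<le> ennreal B" for n
    unfolding massu ur(1) ur(2) using B uB[of n] by (auto intro: ennreal_leI)
  obtain r v where r: "strict_mono (r :: nat \<Rightarrow> nat)" and v[measurable]: "v \<in> borel_measurable borel"
    and AEv: "AE x in lborel. (\<lambda>n. u (q (r n)) x) \<longlonglongrightarrow> v x"
    and L2v: "(\<lambda>n. mass (\<lambda>x. u (q (r n)) x - v x)) \<longlonglongrightarrow> 0"
    using bounded_Sigma_sequence_convergent_subsequence[of "\<lambda>n. u (q n)" B s] B(5) bounds s(1) by auto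
  define U where "U = (\<lambda>n. u (q (r n)))"
  have [measurable]: "U n \<in> borel_measurable borel" for n by (simp add: U_def)
  have AEU: "AE x in lborel. (\<lambda>n. U n x) \<longlonglongrightarrow> v x" and L2U: "(\<lambda>n. mass (\<lambda>x. U n x - v x)) \<longlonglongrightarrow> 0"
    using AEv L2v by (simp_all add: U_def)
  have Ub: "mass (U n) = ennreal (c\<^sup>2)" "gagliardo s (U n) = ennreal (g (U n))" "moment (U n) = ennreal (h (U n))"
    "power_integral p (U n) = ennreal (w (U n))" "gagliardo s (U n) \<le> ennreal B" for n
    unfolding U_def by (rule massu ur(1-3) bounds)+
  have "(\<lambda>n. T (q (r n))) \<longlonglongrightarrow> (lg, lh, lw)"
    using LIMSEQ_subseq_LIMSEQ[OF q(2) r] l by (simp add: comp_def)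
  from tendsto_fst[OF this] tendsto_fst[OF tendsto_snd[OF this]] tendsto_snd[OF tendsto_snd[OF this]]
  have lims: "(\<lambda>n. g (U n)) \<longlonglongrightarrow> lg" "(\<lambda>n. h (U n)) \<longlonglongrightarrow> lh" "(\<lambda>n. w (U n)) \<longlonglongrightarrow> lw"
    by (simp_all add: T_def U_def)
  have l0: "0 \<le> lg" "0 \<le> lh" "0 \<le> lw"
    using lims nonneg by (auto intro: LIMSEQ_le_const)
  have "(\<lambda>n. jr (q (r n))) \<longlonglongrightarrow> i"
    using LIMSEQ_subseq_LIMSEQ[OF jr strict_mono_o[OF q(1) r]] by (simp add: comp_def)
  moreover have "(\<lambda>n. jr (q (r n))) \<longlonglongrightarrow> C / 2 * lg + lh / 2 - lw / p"
    unfolding jr_def U_def[symmetric] using lims(1-3) p by (intro tendsto_intros) (auto simp: U_def)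
  ultimately have i_eq: "i = C / 2 * lg + lh / 2 - lw / p" by (rule LIMSEQ_unique)
  have "gagliardo s v \<le> liminf (\<lambda>n. gagliardo s (U n))" using AEU by (intro gagliardo_le_liminf) auto
  also have "\<dots> = ennreal lg"
    unfolding Ub(2) using lims by (intro lim_imp_Liminf tendsto_ennrealI) auto
  finally have gv: "gagliardo s v \<le> ennreal lg" .
  have "moment v \<le> liminf (\<lambda>n. moment (U n))"
    unfolding moment_def
  proof (rule nn_integral_le_liminf)
    show "AE x in lborel. ennreal ((norm x)\<^sup>2 * (v x)\<^sup>2) \<le> liminf (\<lambda>n. ennreal ((norm x)\<^sup>2 * (U n x)\<^sup>2))"
      using AEU
    proof eventually_elim
      case (elim x)
      have "(\<lambda>n. ennreal ((norm x)\<^sup>2 * (U n x)\<^sup>2)) \<longlonglongrightarrow> ennreal ((norm x)\<^sup>2 * (v x)\<^sup>2)"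
        by (intro tendsto_ennrealI tendsto_intros elim)
      from lim_imp_Liminf[OF sequentially_bot this] show ?case by simp
    qed
  qed simp
  also have "\<dots> = ennreal lh"
    unfolding Ub(3) using lims by (intro lim_imp_Liminf tendsto_ennrealI) auto
  finally have hv: "moment v \<le> ennreal lh" .
  have massv: "mass v \<le> ennreal (c\<^sup>2)"
    unfolding mass_def
  proof (rule nn_integral_le_if_AE_limit)
    show "AE x in lborel. (\<lambda>n. ennreal ((U n x)\<^sup>2)) \<longlonglongrightarrow> ennreal ((v x)\<^sup>2)"
      using AEU by eventually_elim (intro tendsto_ennrealI tendsto_intros)
    show "\<forall>\<^sub>F n in sequentially. (\<integral>\<^sup>+ x. ennreal ((U n x)\<^sup>2) \<partial>lborel) \<le> ennreal (c\<^sup>2)"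
      using Ub(1) by (simp add: mass_def)
  qed simp
  define m where "m = enn2real (mass v)"
  have "mass v < top" using massv by (rule le_less_trans) simp
  then have m: "mass v = ennreal m" "0 \<le> m" by (simp_all add: m_def)
  then have m_le: "m \<le> c\<^sup>2" using massv by (simp add: ennreal_le_iff)
  have "c\<^sup>2 \<le> m + e" if e: "0 < e" for e
  proof -
    have "eventually (\<lambda>n. power_integral 2 (U n) \<le> ennreal (m + e)) sequentially"
      using L2U m e by (intro power_integral_eventually_le[where v = v]) (auto simp: power_integral_2)
    then have "ennreal (c\<^sup>2) \<le> ennreal (m + e)"
      unfolding power_integral_2 Ub(1) by (simp add: eventually_const)
    then show ?thesis using m e by (simp add: ennreal_le_iff del: ennreal_plus)
  qed
  then have "c\<^sup>2 \<le> m" by (rule field_le_epsilon)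
  then have mv: "mass v = ennreal (c\<^sup>2)" using m m_le by simp
  have vS: "v \<in> ?S"
    using gv hv mv by (auto simp: S_constraint_iff intro: measurable_completion le_less_trans)
  note vr = reals[OF vS v]
  have "lg \<le> B" using uB by (intro LIMSEQ_le_const2[OF lims(1)]) (auto simp: U_def)
  then have gvB: "gagliardo s v \<le> ennreal B" using gv by (auto intro: order_trans ennreal_leI)
  have finU: "mass (\<lambda>x. U n x - v x) < \<infinity>" for n
  proof -
    have "mass (\<lambda>x. U n x - v x) \<le> 2 * mass (U n) + 2 * mass v" by (rule mass_diff_le) auto
    also have "\<dots> < \<infinity>" unfolding Ub(1) mv by (simp add: ennreal_mult_less_top)
    finally show ?thesis .
  qed
  have pU: "(\<lambda>n. power_integral p (\<lambda>x. U n x - v x)) \<longlonglongrightarrow> 0"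
    using s p B(5) Ub(5) gvB finU L2U by (intro power_integral_difference_tendsto_0) auto
  have "lw \<le> w v + e" if e: "0 < e" for e
  proof -
    have "eventually (\<lambda>n. power_integral p (U n) \<le> ennreal (w v + e)) sequentially"
      using pU p vr(3) nonneg e by (intro power_integral_eventually_le) auto
    then have "eventually (\<lambda>n. w (U n) \<le> w v + e) sequentially"
      unfolding Ub(4) using nonneg(3)[of v] e by (simp add: ennreal_le_iff del: ennreal_plus)
    then show ?thesis by (rule tendsto_upperbound[OF lims(3)]) simp
  qed
  then have lw: "lw \<le> w v" by (rule field_le_epsilon)
  have "g v \<le> lg" "h v \<le> lh" using gv hv vr(1,2) l0 by (simp_all add: ennreal_le_iff)
  then have "C / 2 * g v + h v / 2 - w v / p \<le> i"
    unfolding i_eq using lw p C by (intro diff_mono add_mono mult_left_mono divide_right_mono) auto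
  then have "?J v \<le> I" using vr(5) i by simp
  moreover have "I \<le> ?J v" unfolding I using vS by (intro Inf_lower) auto
  ultimately show thesis using vS v by (intro that[of v]) (auto simp: I_def)
qed

section \<open>Reflections and polarization\<close>

text \<open>
  This is the uniqueness of translation invariant measures, by Fubini's theorem. With the indicator \<open>\<eta>\<close> of
  the unit ball, the double integral of \<open>\<phi> (f x) * \<eta> (f x + y)\<close> equals \<open>(\<integral>\<phi> (f x)) * V\<close>; the substitution
  \<open>f x \<mapsto> f x - y\<close>, which is a translation of \<open>x\<close>, turns it into \<open>(\<integral>\<phi>) * V\<close> because \<open>\<eta>\<close> is invariant under
  \<open>f\<close>.
\<close>

lemma nn_integral_lborel_orthogonal:
  fixes f :: "'a::euclidean_space \<Rightarrow> 'a" and \<phi> :: "'a \<Rightarrow> ennreal"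
  assumes f: "orthogonal_transformation f" and [measurable]: "\<phi> \<in> borel_measurable borel"
  shows "(\<integral>\<^sup>+x. \<phi> (f x) \<partial>lborel) = (\<integral>\<^sup>+x. \<phi> x \<partial>lborel)"
proof -
  have lin: "linear f" and iso: "\<And>x. norm (f x) = norm x" and surj: "surj f"
    using f by (auto simp: orthogonal_transformation_linear orthogonal_transformation_norm orthogonal_transformation_surj)
  have [measurable]: "f \<in> borel_measurable borel"
    using lin by (intro borel_measurable_continuous_onI linear_continuous_on) (simp add: linear_linear)
  define \<eta> where "\<eta> = (indicator (ball (0::'a) 1) :: 'a \<Rightarrow> ennreal)"
  have [measurable]: "\<eta> \<in> borel_measurable borel" unfolding \<eta>_def by measurable
  have \<eta>f: "\<eta> (f x) = \<eta> x" for x by (simp add: \<eta>_def indicator_def iso)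
  define V where "V = emeasure lborel (ball (0::'a) 1)"
  have V: "V \<noteq> 0" "V \<noteq> \<infinity>" "(\<integral>\<^sup>+x. \<eta> x \<partial>lborel) = V"
    using ball_volume(1)[of 1 "0::'a"] content_ball_pos[of 1 "0::'a"] by (simp_all add: V_def \<eta>_def)
  have "(\<integral>\<^sup>+x. \<phi> (f x) \<partial>lborel) * V = (\<integral>\<^sup>+x. \<integral>\<^sup>+y. \<phi> (f x) * \<eta> (f x + y) \<partial>lborel \<partial>lborel)"
    by (simp add: nn_integral_cmult nn_integral_multc nn_integral_lborel_translate V)
  also have "\<dots> = (\<integral>\<^sup>+y. \<integral>\<^sup>+x. \<phi> (f x) * \<eta> (f x + y) \<partial>lborel \<partial>lborel)"
    by (rule lborel_pair.Fubini') simp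
  also have "\<dots> = (\<integral>\<^sup>+y. \<integral>\<^sup>+x. \<phi> (f x - y) * \<eta> x \<partial>lborel \<partial>lborel)"
  proof (rule nn_integral_cong)
    fix y
    obtain b where b: "y = f b" using surj by (auto simp: surj_def)
    have "(\<integral>\<^sup>+x. \<phi> (f x) * \<eta> (f x + y) \<partial>lborel) = (\<integral>\<^sup>+x. \<phi> (f (x - b)) * \<eta> (f (x - b) + y) \<partial>lborel)"
      by (rule nn_integral_lborel_minus(2)[symmetric]) simp
    also have "\<dots> = (\<integral>\<^sup>+x. \<phi> (f x - y) * \<eta> x \<partial>lborel)"
      by (simp add: b linear_diff[OF lin] \<eta>f)
    finally show "(\<integral>\<^sup>+x. \<phi> (f x) * \<eta> (f x + y) \<partial>lborel) = (\<integral>\<^sup>+x. \<phi> (f x - y) * \<eta> x \<partial>lborel)" .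
  qed
  also have "\<dots> = (\<integral>\<^sup>+x. \<integral>\<^sup>+y. \<phi> (f x - y) * \<eta> x \<partial>lborel \<partial>lborel)"
    by (rule lborel_pair.Fubini') simp
  also have "\<dots> = (\<integral>\<^sup>+x. \<phi> x \<partial>lborel) * V"
    by (simp add: nn_integral_cmult nn_integral_multc nn_integral_lborel_minus V)
  finally have "V * (\<integral>\<^sup>+x. \<phi> (f x) \<partial>lborel) = V * (\<integral>\<^sup>+x. \<phi> x \<partial>lborel)"
    by (simp add: mult.commute)
  then show ?thesis using V by (simp add: ennreal_mult_cancel_left)
qed

text \<open>
  The half-space is \<open>{x. a \<bullet> x \<le> b}\<close>. The origin is an interior point of it when \<open>b > 0\<close>.
\<close>

locale halfspace_reflection =
  fixes a :: "'a::euclidean_space" and b :: real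
  assumes unit: "norm a = 1"
begin

definition \<rho> :: "'a \<Rightarrow> 'a" where
  "\<rho> x = x - (2 * (a \<bullet> x - b)) *\<^sub>R a"

definition polarize :: "('a \<Rightarrow> real) \<Rightarrow> 'a \<Rightarrow> real" where
  "polarize u x = (if a \<bullet> x \<le> b then max (u x) (u (\<rho> x)) else min (u x) (u (\<rho> x)))"

lemma a_a [simp]: "a \<bullet> a = 1"
  using unit by (simp add: norm_eq_1)

lemma inner_\<rho>: "a \<bullet> \<rho> x = 2 * b - a \<bullet> x"
  by (simp add: \<rho>_def inner_diff_right)

lemma \<rho>_\<rho> [simp]: "\<rho> (\<rho> x) = x"
proof -
  have "\<rho> (\<rho> x) = \<rho> x - (2 * (a \<bullet> \<rho> x - b)) *\<^sub>R a" by (rule \<rho>_def)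
  also have "\<dots> = x" unfolding inner_\<rho> by (simp add: \<rho>_def algebra_simps)
  finally show ?thesis .
qed

lemma \<rho>_measurable [measurable]: "\<rho> \<in> borel_measurable borel"
  unfolding \<rho>_def by measurable

lemma polarize_measurable [measurable]:
  assumes [measurable]: "u \<in> borel_measurable borel"
  shows "polarize u \<in> borel_measurable borel"
  unfolding polarize_def by measurable

lemma norm_\<rho>_diff: "norm (\<rho> x - \<rho> y) = norm (x - y)"
proof -
  have "\<rho> x - \<rho> y = (x - y) - (2 * (a \<bullet> (x - y))) *\<^sub>R a"
    by (simp add: \<rho>_def inner_diff_right algebra_simps)
  then have "(\<rho> x - \<rho> y) \<bullet> (\<rho> x - \<rho> y) = (x - y) \<bullet> (x - y)"
    by (simp only: inner_diff_left[of "x - y"] inner_diff_right[of _ "x - y"])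
       (simp add: inner_commute[of "x - y" a])
  then show ?thesis by (simp add: norm_eq_sqrt_inner)
qed

text \<open>
  The product on the right is nonnegative for two points of the same side: reflecting one of them
  moves it away from the other. With the origin in place of \<open>x\<close>, it moves away from the origin.
\<close>

lemma norm_diff_\<rho>: "(norm (x - \<rho> y))\<^sup>2 = (norm (x - y))\<^sup>2 + 4 * (b - a \<bullet> x) * (b - a \<bullet> y)"
proof -
  define t where "t = 2 * (b - a \<bullet> y)"
  have "x - \<rho> y = (x - y) - t *\<^sub>R a" by (simp add: \<rho>_def t_def algebra_simps)
  then have "(norm (x - \<rho> y))\<^sup>2 = (norm (x - y))\<^sup>2 - 2 * t * (a \<bullet> (x - y)) + t\<^sup>2"
    by (simp only: power2_norm_eq_inner inner_diff_left[of "x - y"] inner_diff_right[of _ "x - y"])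
       (simp add: inner_commute[of "x - y" a] power2_eq_square)
  also have "\<dots> = (norm (x - y))\<^sup>2 + 4 * (b - a \<bullet> x) * (b - a \<bullet> y)"
    by (simp add: t_def inner_diff_right power2_eq_square algebra_simps)
  finally show ?thesis .
qed

lemma norm_\<rho>: "(norm (\<rho> x))\<^sup>2 = (norm x)\<^sup>2 + 4 * b * (b - a \<bullet> x)"
  using norm_diff_\<rho>[of 0 x] by simp

lemma \<rho>_fixed: "a \<bullet> x = b \<Longrightarrow> \<rho> x = x"
  by (simp add: \<rho>_def)

lemma nn_integral_\<rho>:
  fixes \<phi> :: "'a \<Rightarrow> ennreal"
  assumes [measurable]: "\<phi> \<in> borel_measurable borel"
  shows "(\<integral>\<^sup>+x. \<phi> (\<rho> x) \<partial>lborel) = (\<integral>\<^sup>+x. \<phi> x \<partial>lborel)"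
proof -
  define R where "R = (\<lambda>x. x - (2 * (a \<bullet> x)) *\<^sub>R a)"
  have "linear R"
    unfolding R_def by (rule linearI) (simp_all add: inner_add_right algebra_simps)
  moreover have "R v \<bullet> R w = v \<bullet> w" for v w
    by (simp add: R_def inner_diff_left inner_diff_right inner_commute[of v a] inner_commute[of w a])
  ultimately have "orthogonal_transformation R" by (simp add: orthogonal_transformation_def)
  then have "(\<integral>\<^sup>+x. \<phi> ((2 * b) *\<^sub>R a + R x) \<partial>lborel) = (\<integral>\<^sup>+x. \<phi> ((2 * b) *\<^sub>R a + x) \<partial>lborel)"
    by (rule nn_integral_lborel_orthogonal) measurable
  also have "\<dots> = (\<integral>\<^sup>+x. \<phi> x \<partial>lborel)" by (rule nn_integral_lborel_translate) simp
  also have "(\<lambda>x. (2 * b) *\<^sub>R a + R x) = \<rho>" by (simp add: fun_eq_iff R_def \<rho>_def algebra_simps)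
  finally show ?thesis by (simp add: fun_eq_iff)
qed

lemma polarize_pair:
  assumes "a \<bullet> x \<le> b"
  shows "polarize u x = max (u x) (u (\<rho> x))" "polarize u (\<rho> x) = min (u x) (u (\<rho> x))"
proof -
  show "polarize u x = max (u x) (u (\<rho> x))" using assms by (simp add: polarize_def)
  show "polarize u (\<rho> x) = min (u x) (u (\<rho> x))"
  proof (cases "a \<bullet> x = b")
    case True
    then show ?thesis by (simp add: polarize_def \<rho>_fixed)
  next
    case False
    then show ?thesis using assms by (simp add: polarize_def inner_\<rho> min.commute)
  qed
qed

lemma \<rho>_cases:
  obtains y where "a \<bullet> y \<le> b" "x = y" | y where "a \<bullet> y \<le> b" "x = \<rho> y"
proof (cases "a \<bullet> x \<le> b")
  case False
  then have "a \<bullet> \<rho> x \<le> b" by (simp add: inner_\<rho>)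
  then show ?thesis using that(2)[of "\<rho> x"] by simp
qed (use that(1) in auto)

text \<open>
  Polarization permutes the two values in every pair \<open>x\<close>, \<open>\<rho> x\<close>, and \<open>\<rho>\<close> preserves the measure.
\<close>

lemma nn_integral_polarize:
  fixes \<phi> :: "real \<Rightarrow> ennreal"
  assumes [measurable]: "u \<in> borel_measurable borel" "\<phi> \<in> borel_measurable borel"
  shows "(\<integral>\<^sup>+x. \<phi> (polarize u x) \<partial>lborel) = (\<integral>\<^sup>+x. \<phi> (u x) \<partial>lborel)"
proof -
  have "\<phi> (polarize u x) + \<phi> (polarize u (\<rho> x)) = \<phi> (u x) + \<phi> (u (\<rho> x))" for x
    by (cases x rule: \<rho>_cases) (auto simp: polarize_pair max_def min_def add.commute)
  then have "(\<integral>\<^sup>+x. \<phi> (polarize u x) + \<phi> (polarize u (\<rho> x)) \<partial>lborel) = (\<integral>\<^sup>+x. \<phi> (u x) + \<phi> (u (\<rho> x)) \<partial>lborel)"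
    by simp
  then have "2 * (\<integral>\<^sup>+x. \<phi> (polarize u x) \<partial>lborel) = 2 * (\<integral>\<^sup>+x. \<phi> (u x) \<partial>lborel)"
    using nn_integral_\<rho>[of "\<lambda>x. \<phi> (polarize u x)"] nn_integral_\<rho>[of "\<lambda>x. \<phi> (u x)"]
    by (simp add: nn_integral_add mult_2)
  then show ?thesis by (simp add: ennreal_mult_cancel_left)
qed

text \<open>
  Ordering both pairs in the same way can only increase \<open>p * q + p' * q'\<close>, while the sum of all four
  products and the sum of the squares stay fixed; and the differences that contain \<open>p * q\<close> and
  \<open>p' * q'\<close> carry the larger weight \<open>k\<close>.
\<close>

lemma four_point_rearrangement:
  fixes p p' q q' :: real
  assumes "k' \<le> k"
  defines "F \<equiv> \<lambda>p p' q q'. k * ((p - q)\<^sup>2 + (p' - q')\<^sup>2) + k' * ((p' - q)\<^sup>2 + (p - q')\<^sup>2)"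
  shows "F (max p p') (min p p') (max q q') (min q q') \<le> F p p' q q'"
proof -
  define X where "X = 2 * (k - k') * ((p - p') * (q' - q))"
  have F: "F p' p q q' = F p p' q q' - X" "F p p' q' q = F p p' q q' - X" "F p' p q' q = F p p' q q'"
    by (simp_all add: F_def X_def power2_eq_square algebra_simps)
  have X: "0 \<le> X" if "(p \<le> p' \<and> q' \<le> q) \<or> (p' \<le> p \<and> q \<le> q')"
    using that assms(1) unfolding X_def
    by (intro mult_nonneg_nonneg[of "2 * (k - k')"]) (auto simp: mult_nonneg_nonneg mult_nonpos_nonpos)
  show ?thesis
    by (cases "p \<le> p'"; cases "q \<le> q'") (simp_all add: max_def min_def F X)
qed

text \<open>
  In each pair, the sum of the squares is preserved and the larger one moves to the point nearer to
  the origin. The gain at an exchanged pair is strictly positive, which is what forces the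
  reflection inequality in the case of equality.
\<close>

lemma moment_polarize:
  assumes [measurable]: "u \<in> borel_measurable borel" and nn: "\<And>x. 0 \<le> u x" and b: "0 < b"
  shows "moment (polarize u) \<le> moment u"
    and "moment (polarize u) = moment u \<Longrightarrow> moment u < \<infinity> \<Longrightarrow>
      AE x in lborel. a \<bullet> x < b \<longrightarrow> u (\<rho> x) \<le> u x"
proof -
  define F where "F = (\<lambda>f x. (norm x)\<^sup>2 * (f x)\<^sup>2 + (norm (\<rho> x))\<^sup>2 * (f (\<rho> x))\<^sup>2 :: real)"
  have [measurable]: "(\<lambda>x. F f x) \<in> borel_measurable borel" if [measurable]: "f \<in> borel_measurable borel" for f
    unfolding F_def by measurable
  have F0: "0 \<le> F f x" for f x by (simp add: F_def)
  have int: "2 * moment f = (\<integral>\<^sup>+x. ennreal (F f x) \<partial>lborel)" if [measurable]: "f \<in> borel_measurable borel" for f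
  proof -
    have "(\<integral>\<^sup>+x. ennreal (F f x) \<partial>lborel)
       = moment f + (\<integral>\<^sup>+x. ennreal ((norm (\<rho> x))\<^sup>2 * (f (\<rho> x))\<^sup>2) \<partial>lborel)"
      unfolding F_def moment_def by (simp add: nn_integral_add)
    also have "(\<integral>\<^sup>+x. ennreal ((norm (\<rho> x))\<^sup>2 * (f (\<rho> x))\<^sup>2) \<partial>lborel) = moment f"
      unfolding moment_def by (rule nn_integral_\<rho>) simp
    finally show ?thesis by (simp add: mult_2)
  qed
  have F\<rho>: "F f (\<rho> x) = F f x" for f x by (simp add: F_def)
  have diff: "F u x - F (polarize u) x = (if u (\<rho> x) \<le> u x then 0
        else 4 * b * (b - a \<bullet> x) * ((u (\<rho> x))\<^sup>2 - (u x)\<^sup>2))" if "a \<bullet> x \<le> b" for x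
    unfolding F_def polarize_pair[OF that] norm_\<rho> by (auto simp: max_def min_def algebra_simps)
  have le: "F (polarize u) x \<le> F u x" if "a \<bullet> x \<le> b" for x
  proof -
    have "0 \<le> F u x - F (polarize u) x"
      unfolding diff[OF that] using that b nn by (auto intro!: mult_nonneg_nonneg power_mono)
    then show ?thesis by simp
  qed
  have le': "F (polarize u) x \<le> F u x" for x
    by (cases x rule: \<rho>_cases) (auto simp: F\<rho> le)
  then have "2 * moment (polarize u) \<le> 2 * moment u"
    by (subst (1 2) int) (auto intro!: nn_integral_mono ennreal_leI)
  then show "moment (polarize u) \<le> moment u" by (simp add: ennreal_mult_le_mult_iff)
  assume eq: "moment (polarize u) = moment u" and fin: "moment u < \<infinity>"
  have "(\<integral>\<^sup>+x. ennreal (F u x) - ennreal (F (polarize u) x) \<partial>lborel)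
      = (\<integral>\<^sup>+x. ennreal (F u x) \<partial>lborel) - (\<integral>\<^sup>+x. ennreal (F (polarize u) x) \<partial>lborel)"
    using fin eq le' by (intro nn_integral_diff) (auto intro!: ennreal_leI simp: int[symmetric] ennreal_mult_eq_top_iff)
  also have "\<dots> = 0" using eq fin by (simp add: int[symmetric] ennreal_mult_eq_top_iff)
  finally have "AE x in lborel. ennreal (F u x) - ennreal (F (polarize u) x) = 0"
    by (subst (asm) nn_integral_0_iff_AE) auto
  then show "AE x in lborel. a \<bullet> x < b \<longrightarrow> u (\<rho> x) \<le> u x"
  proof eventually_elim
    case (elim x)
    show ?case
    proof (intro impI, rule ccontr)
      assume x: "a \<bullet> x < b" and "\<not> u (\<rho> x) \<le> u x"
      then have "0 < 4 * b * (b - a \<bullet> x) * ((u (\<rho> x))\<^sup>2 - (u x)\<^sup>2)"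
        using b nn[of x] by (intro mult_pos_pos) (auto intro: power_strict_mono)
      then have "0 < F u x - F (polarize u) x" using x \<open>\<not> u (\<rho> x) \<le> u x\<close> by (simp add: diff)
      then have "ennreal (F u x) - ennreal (F (polarize u) x) \<noteq> 0"
        using F0 by (simp add: ennreal_minus)
      then show False using elim by simp
    qed
  qed
qed

end

text \<open>
  Four times the energy is the integral of the sum of the integrand over the four pairs formed from
  \<open>x\<close>, \<open>\<rho> x\<close> and \<open>y\<close>, \<open>\<rho> y\<close>. That sum is invariant under \<open>\<rho>\<close> in each variable, so both points may be taken in the
  half-space, where the four-point inequality applies.
\<close>

lemma gagliardo_polarize_le:
  fixes u :: "real ^ 'n \<Rightarrow> real" and a :: "real ^ 'n"
  assumes a: "norm a = 1" and [measurable]: "u \<in> borel_measurable borel" and s: "0 < s"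
  shows "gagliardo s (halfspace_reflection.polarize a b u) \<le> gagliardo s u"
proof -
  interpret halfspace_reflection a b by unfold_locales (rule a)
  define \<beta> where "\<beta> = real CARD('n) + 2 * s"
  have \<beta>: "\<beta> > 0" using s by (simp add: \<beta>_def add_nonneg_pos)
  define \<Phi> where "\<Phi> = (\<lambda>f (x :: real ^ 'n) y. \<bar>f x - f y\<bar>\<^sup>2 / norm (x - y) powr \<beta> :: real)"
  have [measurable]: "(\<lambda>(x, y). \<Phi> f x y) \<in> borel_measurable (borel \<Otimes>\<^sub>M borel)"
    if [measurable]: "f \<in> borel_measurable borel" for f
    unfolding \<Phi>_def by measurable
  have \<Phi>0: "0 \<le> \<Phi> f x y" for f x y by (simp add: \<Phi>_def)
  define F where "F = (\<lambda>f x y. \<Phi> f x y + \<Phi> f (\<rho> x) (\<rho> y) + (\<Phi> f (\<rho> x) y + \<Phi> f x (\<rho> y)))"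
  have sym: "F f (\<rho> x) y = F f x y" "F f x (\<rho> y) = F f x y" for f x y by (simp_all add: F_def)
  have gag: "gagliardo s f = (\<integral>\<^sup>+x. \<integral>\<^sup>+y. ennreal (\<Phi> f x y) \<partial>lborel \<partial>lborel)" for f
    unfolding gagliardo_eq_integral_density frac_density_def \<Phi>_def \<beta>_def ..
  have four: "4 * gagliardo s f = (\<integral>\<^sup>+x. \<integral>\<^sup>+y. ennreal (F f x y) \<partial>lborel \<partial>lborel)"
    if [measurable]: "f \<in> borel_measurable borel" for f
  proof -
    have i1: "(\<integral>\<^sup>+x. \<integral>\<^sup>+y. ennreal (\<Phi> f (\<rho> x) y) \<partial>lborel \<partial>lborel) = gagliardo s f"
      unfolding gag by (rule nn_integral_\<rho>[of "\<lambda>x. \<integral>\<^sup>+y. ennreal (\<Phi> f x y) \<partial>lborel"]) measurable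
    have inner: "(\<integral>\<^sup>+y. ennreal (\<Phi> f x (\<rho> y)) \<partial>lborel) = (\<integral>\<^sup>+y. ennreal (\<Phi> f x y) \<partial>lborel)" for x
      by (rule nn_integral_\<rho>[of "\<lambda>y. ennreal (\<Phi> f x y)"]) measurable
    have "(\<integral>\<^sup>+x. \<integral>\<^sup>+y. ennreal (F f x y) \<partial>lborel \<partial>lborel)
       = (\<integral>\<^sup>+x. \<integral>\<^sup>+y. ennreal (\<Phi> f x y) \<partial>lborel \<partial>lborel) + (\<integral>\<^sup>+x. \<integral>\<^sup>+y. ennreal (\<Phi> f (\<rho> x) (\<rho> y)) \<partial>lborel \<partial>lborel)
        + ((\<integral>\<^sup>+x. \<integral>\<^sup>+y. ennreal (\<Phi> f (\<rho> x) y) \<partial>lborel \<partial>lborel) + (\<integral>\<^sup>+x. \<integral>\<^sup>+y. ennreal (\<Phi> f x (\<rho> y)) \<partial>lborel \<partial>lborel))"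
      unfolding F_def by (simp add: \<Phi>0 nn_integral_add)
    also have "\<dots> = gagliardo s f + gagliardo s f + (gagliardo s f + gagliardo s f)"
      unfolding inner i1 gag[symmetric] ..
    also have "\<dots> = 4 * gagliardo s f" by (simp add: distrib_right[of 2 2, simplified] mult_2)
    finally show ?thesis by simp
  qed
  have half: "F (polarize u) x y \<le> F u x y" if xy: "a \<bullet> x \<le> b" "a \<bullet> y \<le> b" "x \<noteq> y" for x y
  proof -
    define k where "k = 1 / norm (x - y) powr \<beta>"
    define k' where "k' = 1 / norm (x - \<rho> y) powr \<beta>"
    have "(norm (x - y))\<^sup>2 \<le> (norm (x - \<rho> y))\<^sup>2"
      unfolding norm_diff_\<rho> using xy by simp
    then have "norm (x - y) \<le> norm (x - \<rho> y)" by (rule power2_le_imp_le) simp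
    moreover have "0 < norm (x - y)" using xy by simp
    ultimately have k: "k' \<le> k"
      unfolding k_def k'_def using \<beta> by (intro divide_left_mono powr_mono2 mult_pos_pos) auto
    have eqs: "norm (\<rho> x - \<rho> y) = norm (x - y)" "norm (\<rho> x - y) = norm (x - \<rho> y)"
      using norm_\<rho>_diff[of x y] norm_\<rho>_diff[of x "\<rho> y"] by simp_all
    have F: "F f x y = k * ((f x - f y)\<^sup>2 + (f (\<rho> x) - f (\<rho> y))\<^sup>2) + k' * ((f (\<rho> x) - f y)\<^sup>2 + (f x - f (\<rho> y))\<^sup>2)" for f
      unfolding F_def \<Phi>_def eqs k_def k'_def by (simp add: add_divide_distrib)
    show ?thesis
      unfolding F polarize_pair[OF xy(1)] polarize_pair[OF xy(2)]
      by (rule four_point_rearrangement[OF k])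
  qed
  \<comment> \<open>On the excluded null set the kernel takes the default value \<open>0\<close> of a division by
    zero, and the comparison of the two weights fails.\<close>
  have le: "F (polarize u) x y \<le> F u x y" if "x \<noteq> y" "x \<noteq> \<rho> y" for x y
    using that by (cases x rule: \<rho>_cases; cases y rule: \<rho>_cases) (auto simp: sym intro!: half)
  have "4 * gagliardo s (polarize u) \<le> 4 * gagliardo s u"
    unfolding four[OF polarize_measurable[OF \<open>u \<in> borel_measurable borel\<close>]] four[OF \<open>u \<in> borel_measurable borel\<close>]
  proof (rule nn_integral_mono, rule nn_integral_mono_AE)
    fix x
    have "AE y in lborel. y \<noteq> x" "AE y in lborel. y \<noteq> \<rho> x" by (rule AE_lborel_singleton)+
    then show "AE y in lborel. ennreal (F (polarize u) x y) \<le> ennreal (F u x y)"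
      by eventually_elim (auto intro!: ennreal_leI le)
  qed
  then show ?thesis by (simp add: ennreal_mult_le_mult_iff)
qed

section \<open>Minimizers are radially decreasing\<close>

lemma AE_lborel_imp_ex_mem_open:
  fixes U :: "'a::euclidean_space set"
  assumes "AE x in lborel. P x" "open U" "U \<noteq> {}"
  obtains x where "x \<in> U" "P x"
proof -
  obtain z e where z: "0 < e" "ball z e \<subseteq> U" using assms(2,3) by (metis all_not_in_conv openE)
  have "\<exists>x\<in>U. P x"
  proof (rule ccontr)
    assume "\<not> (\<exists>x\<in>U. P x)"
    with assms(1) z(2) have "AE x in lborel. x \<notin> ball z e" by (auto elim!: eventually_mono)
    then have "emeasure lborel (ball z e) = 0" by (subst (asm) AE_iff_measurable[where N = "ball z e"]) auto
    then show False using ball_volume(1)[of e z] content_ball_pos[of 1 "0::'a"] z by simp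
  qed
  then show thesis using that by blast
qed

text \<open>
  The representative at radius \<open>r\<close> is the supremum of \<open>u\<close> over the good points outside the closed ball
  of radius \<open>r\<close>. It can differ from \<open>u\<close> only at jumps of this monotone profile, and two good points
  whose jump contains the same rational number lie on one sphere; so the exceptional set is contained
  in countably many spheres.
\<close>

lemma radially_decreasing_representative:
  fixes u :: "real ^ 'n \<Rightarrow> real"
  assumes P: "AE x in lborel. P x" and nn: "\<And>x. 0 \<le> u x"
    and dec: "\<And>x y. P x \<Longrightarrow> P y \<Longrightarrow> norm x < norm y \<Longrightarrow> u y \<le> u x"
  obtains v where "AE x in lborel. v x = u x" "\<And>x. 0 \<le> v x" "radial v" "radially_decreasing v"
proof -
  define A where "A = (\<lambda>r. {u y | y. P y \<and> r < norm y})"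
  define f where "f = (\<lambda>r. Sup (A r))"
  \<comment> \<open>At radius \<open>0\<close> the supremum may be infinite; the value at the origin is arbitrary.\<close>
  define v where "v = (\<lambda>x::real ^ 'n. if x = 0 then 0 else f (norm x))"
  have ex_out: "\<exists>y. P y \<and> r < norm y" for r
  proof -
    have "open {y::real ^ 'n. r < norm y}" by (intro open_Collect_less continuous_intros)
    moreover obtain y :: "real ^ 'n" where "norm y = max 0 r + 1"
      using vector_choose_size[of "max 0 r + 1"] by auto
    then have "r < norm y" by simp
    then have "{y::real ^ 'n. r < norm y} \<noteq> {}" by auto
    ultimately show ?thesis using AE_lborel_imp_ex_mem_open[OF P] by blast
  qed
  have ne: "A r \<noteq> {}" for r using ex_out[of r] by (auto simp: A_def)
  have bdd: "bdd_above (A r)" if r: "0 < r" for r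
  proof -
    obtain z where "z \<in> ball 0 r" "P z"
    proof (rule AE_lborel_imp_ex_mem_open[OF P open_ball])
      show "ball 0 r \<noteq> ({} :: (real ^ 'n) set)" using r by simp
    qed
    then show ?thesis by (intro bdd_aboveI[of _ "u z"]) (auto simp: A_def intro!: dec)
  qed
  have f0: "0 \<le> f r" if "0 < r" for r
  proof -
    obtain y where "P y" "r < norm y" using ex_out by blast
    then have "u y \<le> f r" unfolding f_def using bdd[OF that] by (intro cSup_upper) (auto simp: A_def)
    then show ?thesis using nn[of y] by linarith
  qed
  have f_mono: "f r' \<le> f r" if "0 < r" "r \<le> r'" for r r'
    unfolding f_def using that ne bdd by (intro cSup_subset_mono) (auto simp: A_def)
  have f_le: "f (norm x) \<le> u x" if "P x" for x
    unfolding f_def using ne by (rule cSup_least) (auto simp: A_def intro: dec that)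
  define S where "S = (\<lambda>q::real. {x. P x \<and> x \<noteq> 0 \<and> f (norm x) < q \<and> q < u x})"
  have "AE x in lborel. x \<notin> S q" for q
  proof (cases "S q = {}")
    case False
    then obtain x where x: "x \<in> S q" by blast
    have no: "\<not> norm y < norm z" if "y \<in> S q" "z \<in> S q" for y z
    proof
      assume "norm y < norm z"
      then have "u z \<le> f (norm y)"
        unfolding f_def using that bdd[of "norm y"] by (intro cSup_upper) (auto simp: A_def S_def)
      then show False using that by (auto simp: S_def)
    qed
    have "norm z = norm x" if "z \<in> S q" for z
      using no[OF x that] no[OF that x] by linarith
    then have sub: "S q \<subseteq> sphere 0 (norm x)" by auto
    have "sphere 0 (norm x) \<in> null_sets lborel"
      using negligible_sphere[of 0 "norm x"] by (auto simp: null_sets_completion_iff negligible_iff_null_sets)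
    then have "AE x' in lborel. x' \<notin> sphere 0 (norm x)" by (rule AE_not_in)
    then show ?thesis by eventually_elim (use sub in blast)
  qed simp
  then have "AE x in lborel. \<forall>q\<in>\<rat>. x \<notin> S q"
    by (subst AE_ball_countable) (auto simp: countable_rat)
  moreover have "AE x::real ^ 'n in lborel. x \<noteq> 0" by (rule AE_lborel_singleton)
  ultimately have "AE x in lborel. v x = u x"
    using P
  proof eventually_elim
    case (elim x)
    show ?case
    proof (rule ccontr)
      assume "v x \<noteq> u x"
      then have "f (norm x) < u x" using elim f_le[of x] by (auto simp: v_def)
      then obtain q where "q \<in> \<rat>" "f (norm x) < q" "q < u x" using Rats_dense_in_real by blast
      then show False using elim by (auto simp: S_def)
    qed
  qed
  moreover have "0 \<le> v x" for x using f0 by (simp add: v_def)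
  moreover have "radial v" by (auto simp: radial_def v_def)
  moreover have "radially_decreasing v"
    using f_mono by (auto simp: radially_decreasing_def v_def)
  ultimately show thesis by (rule that)
qed

definition ball_average :: "('a::euclidean_space \<Rightarrow> real) \<Rightarrow> real \<Rightarrow> 'a \<Rightarrow> real" where
  "ball_average u r x = (LINT y:ball x r|lborel. u y) / measure lborel (ball x r)"

lemma ball_average_tendsto:
  fixes u :: "real ^ 'n \<Rightarrow> real"
  assumes [measurable]: "u \<in> borel_measurable borel" and "mass u < \<infinity>" and s: "0 < s"
    and fin: "frac_density s u x < \<infinity>"
  shows "(\<lambda>k. ball_average u (1 / real (Suc k)) x) \<longlonglongrightarrow> u x"
proof -
  define V where "V = measure lborel (ball (0::real ^ 'n) 1)"
  have V: "V > 0" unfolding V_def by (rule content_ball_pos) simp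
  obtain g where g: "frac_density s u x = ennreal g" "0 \<le> g"
    using fin by (cases "frac_density s u x") auto
  have est: "(u x - ball_average u r x)\<^sup>2 \<le> g / V * r powr (2 * s)" if r: "0 < r" for r
  proof -
    have vol: "measure lborel (ball x r) = r ^ CARD('n) * V"
      using ball_volume(2)[of r x] r by (simp add: V_def)
    have "ennreal ((u x - ball_average u r x)\<^sup>2)
      \<le> ennreal (r powr (real CARD('n) + 2 * s) / measure lborel (ball x r)) * frac_density s u x"
      unfolding ball_average_def using r V s assms vol emeasure_lborel_ball_finite[of x r]
      by (intro deviation_from_average_le set_integrable_if_mass_finite) (auto simp: dist_norm)
    also have "\<dots> = ennreal (g / V * r powr (2 * s))"
      unfolding vol g(1) using r V g(2)
      by (simp flip: ennreal_mult' add: powr_add powr_realpow mult_ac)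
    finally show ?thesis using V g by (subst (asm) ennreal_le_iff) auto
  qed
  have "(\<lambda>k. (1 / real (Suc k)) powr (2 * s)) \<longlonglongrightarrow> 0"
    using s by (intro tendsto_zero_powrI[where b = "2 * s"] lim_1_over_n[THEN LIMSEQ_Suc]) auto
  then have "(\<lambda>k. g / V * (1 / real (Suc k)) powr (2 * s)) \<longlonglongrightarrow> 0"
    by (rule tendsto_mult_right_zero)
  then have "(\<lambda>k. (u x - ball_average u (1 / real (Suc k)) x)\<^sup>2) \<longlonglongrightarrow> 0"
    by (rule Lim_null_comparison[rotated], intro always_eventually allI)
       (use est in \<open>simp del: of_nat_Suc\<close>)
  from tendsto_real_sqrt[OF this]
  have "(\<lambda>k. u x - ball_average u (1 / real (Suc k)) x) \<longlonglongrightarrow> 0"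
    by (simp only: real_sqrt_abs real_sqrt_zero tendsto_rabs_zero_iff)
  then have "(\<lambda>k. u x - (u x - ball_average u (1 / real (Suc k)) x)) \<longlonglongrightarrow> u x - 0"
    by (intro tendsto_intros)
  then show ?thesis by simp
qed

text \<open>
  The reflection that exchanges \<open>x\<close> and \<open>y\<close> also exchanges the two balls, and the condition on \<open>r\<close> keeps
  the ball around \<open>x\<close> inside the half-space.
\<close>

lemma ball_average_decreasing:
  fixes u :: "'a::euclidean_space \<Rightarrow> real"
  assumes [measurable]: "u \<in> borel_measurable borel" and mass: "mass u < \<infinity>" and nn: "\<And>x. 0 \<le> u x"
    and refl: "\<And>a b. norm a = 1 \<Longrightarrow> 0 < b \<Longrightarrow>
      AE z in lborel. a \<bullet> z < b \<longrightarrow> u (halfspace_reflection.\<rho> a b z) \<le> u z"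
    and xy: "norm x < norm y" and r: "0 < r" "2 * r \<le> norm (x - y)"
  shows "ball_average u r y \<le> ball_average u r x"
proof -
  define t where "t = norm (y - x)"
  have t: "t > 0" using xy by (auto simp: t_def)
  define a where "a = (y - x) /\<^sub>R t"
  define b where "b = a \<bullet> (x + y) / 2"
  have a: "norm a = 1" using t by (simp add: a_def t_def)
  interpret halfspace_reflection a b by unfold_locales (rule a)
  have "(y - x) \<bullet> (x + y) = (norm y)\<^sup>2 - (norm x)\<^sup>2"
    by (simp add: power2_norm_eq_inner algebra_simps inner_commute)
  moreover have "(norm x)\<^sup>2 < (norm y)\<^sup>2" using xy by (intro power_strict_mono) auto
  ultimately have b: "b > 0" using t by (simp add: b_def a_def)
  have ta: "t *\<^sub>R a = y - x" using t by (simp add: a_def)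
  have "a \<bullet> (y - x) = t" by (simp flip: ta)
  then have ay: "a \<bullet> x - b = - t / 2" by (simp add: b_def inner_diff_right inner_add_right field_simps)
  have \<rho>x: "\<rho> x = y" using ta by (simp add: \<rho>_def ay)
  have ball: "\<rho> z \<in> ball y r \<longleftrightarrow> z \<in> ball x r" for z
    using norm_\<rho>_diff[of x z] by (simp add: \<rho>x dist_norm)
  have inside: "a \<bullet> z < b" if "z \<in> ball x r" for z
  proof -
    have "a \<bullet> (z - x) \<le> norm (z - x)" using Cauchy_Schwarz_ineq2[of a "z - x"] a by simp
    also have "\<dots> < r" using that by (simp add: dist_norm norm_minus_commute)
    also have "r \<le> t / 2" using r by (simp add: t_def norm_minus_commute)
    finally show ?thesis using ay by (simp add: inner_diff_right)
  qed
  have int: "ennreal (LINT z:ball w r|lborel. u z) = (\<integral>\<^sup>+z. ennreal (indicator (ball w r) z * u z) \<partial>lborel)" for w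
  proof -
    have "set_integrable lborel (ball w r) u"
      using mass emeasure_lborel_ball_finite[of w r] by (intro set_integrable_if_mass_finite) auto
    then show ?thesis
      unfolding set_lebesgue_integral_def set_integrable_def using nn
      by (subst nn_integral_eq_integral) auto
  qed
  have "(\<integral>\<^sup>+z. ennreal (indicator (ball y r) z * u z) \<partial>lborel)
      = (\<integral>\<^sup>+z. ennreal (indicator (ball y r) (\<rho> z) * u (\<rho> z)) \<partial>lborel)"
    by (rule nn_integral_\<rho>[symmetric]) measurable
  also have "\<dots> \<le> (\<integral>\<^sup>+z. ennreal (indicator (ball x r) z * u z) \<partial>lborel)"
  proof (rule nn_integral_mono_AE)
    show "AE z in lborel. ennreal (indicator (ball y r) (\<rho> z) * u (\<rho> z)) \<le> ennreal (indicator (ball x r) z * u z)"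
      using refl[OF a b]
    proof eventually_elim
      case (elim z)
      then show ?case using inside[of z] ball[of z] by (auto simp: indicator_def intro!: ennreal_leI simp del: mem_ball)
    qed
  qed
  finally have "ennreal (LINT z:ball y r|lborel. u z) \<le> ennreal (LINT z:ball x r|lborel. u z)"
    unfolding int .
  moreover have "0 \<le> (LINT z:ball x r|lborel. u z)"
    unfolding set_lebesgue_integral_def using nn by (intro Bochner_Integration.integral_nonneg) auto
  ultimately have "(LINT z:ball y r|lborel. u z) \<le> (LINT z:ball x r|lborel. u z)"
    by (simp add: ennreal_le_iff)
  moreover have "measure lborel (ball y r) = measure lborel (ball x r)"
    using r ball_volume(2)[of r x] ball_volume(2)[of r y] by simp
  ultimately show ?thesis
    unfolding ball_average_def by (simp add: divide_right_mono)
qed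

lemma gagliardo_abs_le: "gagliardo s (\<lambda>x. \<bar>u x\<bar>) \<le> gagliardo s u" for u :: "real ^ 'n \<Rightarrow> real"
  unfolding gagliardo_eq_integral_density frac_density_def
proof (rule nn_integral_mono, rule nn_integral_mono, intro ennreal_leI divide_right_mono)
  show "\<bar>\<bar>u x\<bar> - \<bar>u y\<bar>\<bar>\<^sup>2 \<le> \<bar>u x - u y\<bar>\<^sup>2" for x y
    by (intro power_mono) auto
qed simp

text \<open>
  The polarization of \<open>u\<close> competes with \<open>u\<close>, and no term of its energy is worse. Minimality thus
  forces equality of the second moments.
\<close>

lemma minimizer_reflection_monotone:
  fixes u :: "real ^ 'n \<Rightarrow> real"
  assumes u[measurable]: "u \<in> borel_measurable borel" and uS: "u \<in> S_constraint C s c"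
    and J: "J_functional C s \<sigma> u = I_min TYPE('n) C s \<sigma> c" and nn: "\<And>x. 0 \<le> u x"
    and fin: "power_integral (2 * \<sigma> + 2) u < \<infinity>"
    and s: "0 < s" and C: "0 < C" and \<sigma>: "0 < \<sigma>" and a: "norm a = 1" and b: "0 < b"
  shows "AE z in lborel. a \<bullet> z < b \<longrightarrow> u (halfspace_reflection.\<rho> a b z) \<le> u z"
proof -
  interpret halfspace_reflection a b by unfold_locales (rule a)
  let ?v = "polarize u"
  have v: "?v \<in> borel_measurable borel" by (rule polarize_measurable[OF u])
  have g: "gagliardo s ?v \<le> gagliardo s u" by (rule gagliardo_polarize_le[OF a u s])
  have m: "moment ?v \<le> moment u" by (rule moment_polarize(1)[OF u nn b])
  have mass: "mass ?v = mass u"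
    unfolding mass_def by (rule nn_integral_polarize[OF u, of "\<lambda>t. ennreal (t\<^sup>2)"]) measurable
  have p: "power_integral (2 * \<sigma> + 2) ?v = power_integral (2 * \<sigma> + 2) u"
    unfolding power_integral_def
    by (rule nn_integral_polarize[OF u, of "\<lambda>t. ennreal (\<bar>t\<bar> powr (2 * \<sigma> + 2))"]) measurable
  have ufin: "gagliardo s u < \<infinity>" "moment u < \<infinity>" using uS by (auto simp: S_constraint_iff)
  have vS: "?v \<in> S_constraint C s c"
    using uS g m mass v by (auto simp: S_constraint_iff intro: measurable_completion le_less_trans)
  have r: "ennreal (enn2real e) = e" if "e < \<infinity>" for e using that by simp
  have vfin: "gagliardo s ?v < \<infinity>" "moment ?v < \<infinity>" "power_integral (2 * \<sigma> + 2) ?v < \<infinity>"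
    using g m p ufin fin by (auto intro: le_less_trans)
  have "J_functional C s \<sigma> u \<le> J_functional C s \<sigma> ?v"
    unfolding J I_min_def using vS by (rule INF_lower)
  then have "C / 2 * enn2real (gagliardo s u) + enn2real (moment u) / 2 - enn2real (power_integral (2 * \<sigma> + 2) u) / (2 * \<sigma> + 2)
      \<le> C / 2 * enn2real (gagliardo s ?v) + enn2real (moment ?v) / 2 - enn2real (power_integral (2 * \<sigma> + 2) ?v) / (2 * \<sigma> + 2)"
    using C \<sigma> r[OF ufin(1)] r[OF ufin(2)] r[OF fin] r[OF vfin(1)] r[OF vfin(2)] r[OF vfin(3)]
    by (subst (asm) (1 2) J_functional_real) auto
  moreover have "C / 2 * enn2real (gagliardo s ?v) \<le> C / 2 * enn2real (gagliardo s u)"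
    using C g ufin by (intro mult_left_mono enn2real_mono) auto
  ultimately have "enn2real (moment u) \<le> enn2real (moment ?v)" unfolding p by linarith
  then have "moment u \<le> moment ?v"
    using r[OF ufin(2)] r[OF vfin(2)] ennreal_leI by metis
  then show ?thesis using moment_polarize(2)[OF u nn b] m ufin by auto
qed

lemma abs_minimizer:
  fixes u :: "real ^ 'n \<Rightarrow> real"
  assumes u[measurable]: "u \<in> borel_measurable borel" and uS: "u \<in> S_constraint C s c"
    and J: "J_functional C s \<sigma> u = I_min TYPE('n) C s \<sigma> c"
  shows "(\<lambda>x. \<bar>u x\<bar>) \<in> S_constraint C s c" "J_functional C s \<sigma> (\<lambda>x. \<bar>u x\<bar>) = I_min TYPE('n) C s \<sigma> c"
proof -
  let ?v = "\<lambda>x. \<bar>u x\<bar>"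
  have eqs: "mass ?v = mass u" "moment ?v = moment u" "power_integral p ?v = power_integral p u" for p
    by (simp_all add: mass_def moment_def power_integral_def)
  have "?v \<in> borel_measurable lebesgue" by (intro measurable_completion) simp
  then show vS: "?v \<in> S_constraint C s c"
    using uS gagliardo_abs_le[of s u] eqs by (auto simp: S_constraint_iff intro: le_less_trans)
  have "J_functional C s \<sigma> ?v \<le> J_functional C s \<sigma> u"
    unfolding J_functional_eq eqs using gagliardo_abs_le[of s u]
    by (intro ereal_minus_mono add_mono ereal_mult_left_mono order_refl)
       (auto simp: less_eq_ennreal.rep_eq[symmetric] intro!: mult_left_mono)
  moreover have "I_min TYPE('n) C s \<sigma> c \<le> J_functional C s \<sigma> ?v"
    unfolding I_min_def using vS by (rule INF_lower)
  ultimately show "J_functional C s \<sigma> ?v = I_min TYPE('n) C s \<sigma> c" unfolding J by (rule antisym)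
qed

theorem theorem2p1:
  fixes s c \<sigma> C :: real
  assumes "0 < s" and "s < 1" and "0 < c" and "0 < C"
    and "0 < \<sigma>" and "\<sigma> < 2 * s / real CARD('n::finite)"
  shows "\<exists>u :: real ^ 'n \<Rightarrow> real.
           u \<in> S_constraint C s c
         \<and> J_functional C s \<sigma> u = I_min TYPE('n) C s \<sigma> c
         \<and> (\<forall>x. 0 \<le> u x) \<and> radial u \<and> radially_decreasing u"
proof -
  obtain u0 :: "real ^ 'n \<Rightarrow> real" where u0: "u0 \<in> borel_measurable borel" "u0 \<in> S_constraint C s c"
    "J_functional C s \<sigma> u0 = I_min TYPE('n) C s \<sigma> c"
    using minimizer_exists[OF assms] by blast
  define u where "u = (\<lambda>x. \<bar>u0 x\<bar>)"
  have u[measurable]: "u \<in> borel_measurable borel" using u0(1) by (simp add: u_def)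
  have uS: "u \<in> S_constraint C s c" and J: "J_functional C s \<sigma> u = I_min TYPE('n) C s \<sigma> c"
    unfolding u_def using abs_minimizer[OF u0] by simp_all
  have nn: "0 \<le> u x" for x by (simp add: u_def)
  have fin: "mass u < \<infinity>" "gagliardo s u < \<infinity>" using uS by (auto simp: S_constraint_iff)
  have pfin: "power_integral (2 * \<sigma> + 2) u < \<infinity>"
  proof -
    obtain D where D: "\<And>u :: real ^ 'n \<Rightarrow> real. u \<in> borel_measurable borel \<Longrightarrow> mass u = ennreal (c\<^sup>2) \<Longrightarrow>
      power_integral (2 * \<sigma> + 2) u \<le> ennreal D + ennreal 1 * gagliardo s u"
      using power_integral_coercive[OF assms(1,3,5,6), of 1] by auto
    have "power_integral (2 * \<sigma> + 2) u \<le> ennreal D + ennreal 1 * gagliardo s u"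
      using uS by (intro D u) (simp add: S_constraint_iff)
    also have "\<dots> < \<infinity>" using fin by simp
    finally show ?thesis .
  qed
  have refl: "AE z in lborel. a \<bullet> z < b \<longrightarrow> u (halfspace_reflection.\<rho> a b z) \<le> u z" if "norm a = 1" "0 < b" for a b
    using minimizer_reflection_monotone[OF u uS J nn pfin] assms that by blast
  have P: "AE x in lborel. frac_density s u x < \<infinity>"
    using fin nn_integral_PInf_AE[of "frac_density s u" lborel]
    by (simp add: gagliardo_eq_integral_density less_top)
  have dec: "u y \<le> u x" if "frac_density s u x < \<infinity>" "frac_density s u y < \<infinity>" "norm x < norm y" for x y
  proof (rule LIMSEQ_le)
    show "(\<lambda>k. ball_average u (1 / real (Suc k)) y) \<longlonglongrightarrow> u y" "(\<lambda>k. ball_average u (1 / real (Suc k)) x) \<longlonglongrightarrow> u x"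
      using that fin assms by (intro ball_average_tendsto u; simp)+
    have "norm (x - y) > 0" using that by auto
    moreover have "(\<lambda>k. 1 / real (Suc k)) \<longlonglongrightarrow> 0" by (rule lim_1_over_n[THEN LIMSEQ_Suc])
    ultimately have "eventually (\<lambda>k. 1 / real (Suc k) < norm (x - y) / 2) sequentially"
      by (intro order_tendstoD(2)) auto
    then have "eventually (\<lambda>k. ball_average u (1 / real (Suc k)) y \<le> ball_average u (1 / real (Suc k)) x) sequentially"
      by eventually_elim (rule ball_average_decreasing[OF u fin(1) nn refl that(3)], auto)
    then show "\<exists>N. \<forall>k\<ge>N. ball_average u (1 / real (Suc k)) y \<le> ball_average u (1 / real (Suc k)) x"
      by (simp add: eventually_sequentially)
  qed
  obtain v where v: "AE x in lborel. v x = u x" "\<And>x. 0 \<le> v x" "radial v" "radially_decreasing v"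
  proof (rule radially_decreasing_representative[OF P nn])
    show "u y \<le> u x" if "frac_density s u x < \<infinity>" "frac_density s u y < \<infinity>" "norm x < norm y" for x y
      using that by (rule dec)
  qed (rule that)
  have "v \<in> borel_measurable lebesgue"
  proof (rule borel_measurable_AE)
    show "u \<in> borel_measurable lebesgue" by (intro measurable_completion) simp
    show "AE x in lebesgue. u x = v x" using v(1) by (intro AE_completion) auto
  qed
  then have "v \<in> S_constraint C s c"
    using uS mass_cong_AE[OF v(1)] moment_cong_AE[OF v(1)] gagliardo_cong_AE[OF v(1)] by (simp add: S_constraint_iff)
  moreover have "J_functional C s \<sigma> v = I_min TYPE('n) C s \<sigma> c"
    by (simp add: J_functional_eq gagliardo_cong_AE[OF v(1)] moment_cong_AE[OF v(1)] power_integral_cong_AE[OF v(1)]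
        flip: J)
  ultimately show ?thesis using v by blast
qed

end
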